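(* Let $\varphi(\ell)=\ell$. Then the only minimal geodesics in $B_i(S^1,\mathbb{R}^2)$ for the metric $G^{\varphi}$ are the paths along which $|c_t^{\perp}|\,\ell$ is constant; that is, a path $c(t,\theta)$ is a minimal geodesic if and only if the quantity $|c_t^{\perp}(t,\theta)|\,\ell(c(t,\cdot))$ is independent of both $t$ and $\theta$.
   Context: $Imm(S^1,\mathbb{R}^2)$ is the space of $C^\infty$ immersions $S^1\to\mathbb{R}^2$, $B_i(S^1,\mathbb{R}^2)=Imm(S^1,\mathbb{R}^2)/Diff(S^1)$ is its quotient by reparametrization, and $\pi:Imm(S^1,\mathbb{R}^2)\to B_i(S^1,\mathbb{R}^2)$ is the projection. For an immersion $c$, put $c_\theta=dc/d\theta$, $n_c=ic_\theta/|c_\theta|$ (identifying $\mathbb{R}^2=\mathbb{C}$), and $\ell=\ell(c)=\int_{S^1}|c_\theta|\,d\theta$. For a positive function $\varphi$ of $\ell$, and $h,k\in C^\infty(S^1,\mathbb{R}^2)$ regarded as tangent vectors at $c$, $$G^{\varphi}_c(h,k)=\varphi(\ell(c))\int_{S^1}(h\cdot k)\,|c_\theta|\,d\theta .$$ A path is a smooth path $t\mapsto c(t,\cdot)\in Imm(S^1,\mathbb{R}^2)$, $0\le t\le1$; it connects $\pi(c(0,\cdot))$ to $\pi(c(1,\cdot))$ in $B_i(S^1,\mathbb{R}^2)$. Write $c_t=\partial c/\partial t$ and $c_t^{\perp}=(c_t\cdot n_c)n_c$. Then $$L_{G^{\varphi}}(c)=\int_0^1\sqrt{G^{\varphi}_c(c_t^{\perp},c_t^{\perp})}\,dt,\qquad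 \mathrm{dist}_{G^{\varphi}}(C_1,C_2)=\inf_c L_{G^{\varphi}}(c),$$ the infimum being over all paths connecting $C_1$ to $C_2$. A minimal geodesic is a path $c$ with $L_{G^\varphi}(c)=\mathrm{dist}_{G^\varphi}(\pi(c(0,\cdot)),\pi(c(1,\cdot)))$, parametrized so that its speed $\sqrt{G^{\varphi}_c(c_t^{\perp},c_t^{\perp})}$ is constant in $t$.
   Formalization: Diff(S^1) is taken to be the orientation-preserving diffeomorphisms, so B_i consists of oriented curves; with the full Diff(S^1) the "if" direction fails for some paths of rotation index 0 (parallel curves of a symmetric figure eight). *)

theory Defs
  imports "HOL-Analysis.Analysis"
begin

text \<open>
  \<open>k\<close>-fold continuous differentiability on a set. It is only used for \<open>S = UNIV\<close> and for the
  strip \<open>{0..1} \<times> UNIV\<close>; there the derivative within \<open>S\<close> is unique, and at the boundary of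
  the strip it is one-sided in the first variable. The values of \<open>f\<close> outside \<open>S\<close> do not matter.
\<close>

primrec Ck_on :: "nat \<Rightarrow> 'a::real_normed_vector set \<Rightarrow> ('a \<Rightarrow> 'b::real_normed_vector) \<Rightarrow> bool" where
  "Ck_on 0 S f \<longleftrightarrow> continuous_on S f"
| "Ck_on (Suc k) S f \<longleftrightarrow>
     (\<exists>f'. (\<forall>x\<in>S. (f has_derivative f' x) (at x within S)) \<and> (\<forall>v. Ck_on k S (\<lambda>x. f' x v)))"

definition smooth_on :: "'a::real_normed_vector set \<Rightarrow> ('a \<Rightarrow> 'b::real_normed_vector) \<Rightarrow> bool" where
  "smooth_on S f \<longleftrightarrow> (\<forall>k. Ck_on k S f)"

text \<open>
  The circle is \<open>\<real> / 2\<pi>\<int>\<close> and the plane is \<^typ>\<open>complex\<close>: functions on the circle are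
  \<open>2\<pi>\<close>-periodic functions of \<open>\<theta>\<close>.
\<close>

definition Imm :: "(real \<Rightarrow> complex) set" where
  "Imm = {c. smooth_on UNIV c \<and> (\<forall>\<theta>. c (\<theta> + 2 * pi) = c \<theta>) \<and>
             (\<forall>\<theta>. vector_derivative c (at \<theta>) \<noteq> 0)}"

text \<open>
  Reparametrizations are the orientation-preserving diffeomorphisms of the circle, represented by
  their lifts to the line; a smooth lift with positive derivative has a smooth inverse. So the
  points of \<open>B_i\<close> are oriented immersed curves. If reversal of orientation were allowed as well,
  a curve and its reverse would be identified and a path of parallel curves of rotation index
  \<open>0\<close> need no longer be minimal: take the figure eight \<open>m\<close> with \<open>m (-\<theta>) = - m \<theta>\<close> and the path
  from \<open>m - s n\<close> to \<open>m + s n\<close> with \<open>n\<close> the unit normal; its ends are, up to orientation,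
  congruent by a half turn, and a rigid motion can join them at smaller cost.
\<close>

definition Diff_S1 :: "(real \<Rightarrow> real) set" where
  "Diff_S1 = {\<phi>. smooth_on UNIV \<phi> \<and> (\<forall>\<theta>. \<phi> (\<theta> + 2 * pi) = \<phi> \<theta> + 2 * pi) \<and>
                (\<forall>\<theta>. deriv \<phi> \<theta> > 0)}"

definition reparam_rel :: "((real \<Rightarrow> complex) \<times> (real \<Rightarrow> complex)) set" where
  "reparam_rel = {(c, d). c \<in> Imm \<and> d \<in> Imm \<and> (\<exists>\<phi>\<in>Diff_S1. d = c \<circ> \<phi>)}"

definition B_i :: "(real \<Rightarrow> complex) set set" where
  "B_i = Imm // reparam_rel"

definition proj_B_i :: "(real \<Rightarrow> complex) \<Rightarrow> (real \<Rightarrow> complex) set" where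
  "proj_B_i c = reparam_rel `` {c}"

definition curve_length :: "(real \<Rightarrow> complex) \<Rightarrow> real" where
  "curve_length c = integral {0..2 * pi} (\<lambda>\<theta>. norm (vector_derivative c (at \<theta>)))"

definition unit_normal :: "(real \<Rightarrow> complex) \<Rightarrow> real \<Rightarrow> complex" where
  "unit_normal c \<theta> =
     \<i> * vector_derivative c (at \<theta>) / complex_of_real (norm (vector_derivative c (at \<theta>)))"

definition metric_G ::
  "(real \<Rightarrow> real) \<Rightarrow> (real \<Rightarrow> complex) \<Rightarrow> (real \<Rightarrow> complex) \<Rightarrow> (real \<Rightarrow> complex) \<Rightarrow> real" where
  "metric_G \<phi> c h k =
     \<phi> (curve_length c) *
     integral {0..2 * pi} (\<lambda>\<theta>. (h \<theta> \<bullet> k \<theta>) * norm (vector_derivative c (at \<theta>)))"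

definition imm_path :: "(real \<Rightarrow> real \<Rightarrow> complex) \<Rightarrow> bool" where
  "imm_path c \<longleftrightarrow> smooth_on ({0..1} \<times> UNIV) (\<lambda>(t, \<theta>). c t \<theta>) \<and> (\<forall>t\<in>{0..1}. c t \<in> Imm)"

definition connects ::
  "(real \<Rightarrow> real \<Rightarrow> complex) \<Rightarrow> (real \<Rightarrow> complex) set \<Rightarrow> (real \<Rightarrow> complex) set \<Rightarrow> bool" where
  "connects c C1 C2 \<longleftrightarrow> imm_path c \<and> proj_B_i (c 0) = C1 \<and> proj_B_i (c 1) = C2"

definition velocity :: "(real \<Rightarrow> real \<Rightarrow> complex) \<Rightarrow> real \<Rightarrow> real \<Rightarrow> complex" where
  "velocity c t \<theta> = vector_derivative (\<lambda>s. c s \<theta>) (at t within {0..1})"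

definition normal_velocity :: "(real \<Rightarrow> real \<Rightarrow> complex) \<Rightarrow> real \<Rightarrow> real \<Rightarrow> complex" where
  "normal_velocity c t \<theta> =
     (velocity c t \<theta> \<bullet> unit_normal (c t) \<theta>) *\<^sub>R unit_normal (c t) \<theta>"

definition speed :: "(real \<Rightarrow> real) \<Rightarrow> (real \<Rightarrow> real \<Rightarrow> complex) \<Rightarrow> real \<Rightarrow> real" where
  "speed \<phi> c t = sqrt (metric_G \<phi> (c t) (normal_velocity c t) (normal_velocity c t))"

definition path_length_G :: "(real \<Rightarrow> real) \<Rightarrow> (real \<Rightarrow> real \<Rightarrow> complex) \<Rightarrow> real" where
  "path_length_G \<phi> c = integral {0..1} (speed \<phi> c)"

text \<open>Extended reals, so that the distance is \<open>\<infinity>\<close> when no path connects the two curves.\<close>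

definition dist_G ::
  "(real \<Rightarrow> real) \<Rightarrow> (real \<Rightarrow> complex) set \<Rightarrow> (real \<Rightarrow> complex) set \<Rightarrow> ereal" where
  "dist_G \<phi> C1 C2 = (INF c\<in>{c. connects c C1 C2}. ereal (path_length_G \<phi> c))"

definition minimal_geodesic :: "(real \<Rightarrow> real) \<Rightarrow> (real \<Rightarrow> real \<Rightarrow> complex) \<Rightarrow> bool" where
  "minimal_geodesic \<phi> c \<longleftrightarrow>
     imm_path c \<and>
     ereal (path_length_G \<phi> c) = dist_G \<phi> (proj_B_i (c 0)) (proj_B_i (c 1)) \<and>
     (\<exists>v. \<forall>t\<in>{0..1}. speed \<phi> c t = v)"

end

theory Submission
  imports Defs
begin

text \<open>
  For a path \<open>c\<close> let \<open>p\<close> be the norm of the tangent \<open>c\<^sub>\<theta>\<close>, and let \<open>J\<close> be the cross product of the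
  velocity \<open>c\<^sub>t\<close> and the tangent, the signed area swept out per unit of \<open>t\<close> and \<open>\<theta>\<close>. The normal
  speed of a point is \<open>\<bar>J\<bar> / p\<close>, and for \<open>\<phi> = (\<lambda>l. l)\<close> the squared speed of the path is
  \<open>\<ell> * \<integral> J\<^sup>2 / p d\<theta>\<close>. By the Cauchy-Schwarz inequality the speed is at least \<open>\<integral> \<bar>J\<bar> d\<theta>\<close>,
  with equality if and only if the normal speed does not depend on \<open>\<theta>\<close>. So the length of a path
  is at least the area that it sweeps out.

  If the normal speed times \<open>\<ell>\<close> is constant, then \<open>J\<close> does not change sign, and the length of the
  path equals the difference of the signed areas enclosed by its two end curves. This difference
  depends only on the ends in \<open>B_i\<close> and bounds the length of every path between them from below
  (\<open>area_difference_le_path_length\<close>), so the path is minimal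
  (\<open>uniform_normal_speed_imp_minimal_geodesic\<close>).

  Conversely let \<open>c\<close> have constant speed \<open>v\<close>. At each time the mean over arc length of the squared
  normal speed, times \<open>\<ell>\<^sup>2\<close>, is \<open>v\<^sup>2\<close>. So if the normal speed times \<open>\<ell>\<close> is not constant, it
  exceeds \<open>v\<close> somewhere. Near such a point it is profitable to lengthen the curves: a small steep
  tooth increases \<open>p\<close> and hardly changes \<open>J\<close>, and this lowers the cost
  (\<open>density_decreases_at_point\<close>). The resulting path has the same ends and is shorter
  (\<open>exists_shorter_path\<close>), so \<open>c\<close> is not minimal.
\<close>

section \<open>Smooth functions\<close>

lemma Ck_on_SucD: "Ck_on (Suc k) S f \<Longrightarrow> Ck_on k S f"
proof (induction k arbitrary: f)
  case 0
  then show ?case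
    by (auto intro: has_derivative_continuous_on)
next
  case (Suc k)
  then obtain f' where "\<forall>x\<in>S. (f has_derivative f' x) (at x within S)"
    and "\<forall>v. Ck_on (Suc k) S (\<lambda>x. f' x v)"
    by (metis Ck_on.simps(2))
  then show ?case
    using Suc.IH by auto
qed

lemma smooth_on_imp_continuous_on: "smooth_on S f \<Longrightarrow> continuous_on S f"
  unfolding smooth_on_def by (metis Ck_on.simps(1))

lemma Ck_on_const: "Ck_on k S (\<lambda>x. a)"
proof (induction k arbitrary: a)
  case (Suc k)
  then show ?case by (auto intro!: exI[of _ "\<lambda>x v. 0"])
qed auto

lemma Ck_on_bounded_linear:
  assumes "bounded_linear L" "Ck_on k S f"
  shows "Ck_on k S (\<lambda>x. L (f x))"
  using assms(2)
proof (induction k arbitrary: f)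
  case 0
  then show ?case
    by (auto intro: bounded_linear.continuous_on[OF assms(1)])
next
  case (Suc k)
  then obtain f' where f': "\<forall>x\<in>S. (f has_derivative f' x) (at x within S)"
    "\<forall>v. Ck_on k S (\<lambda>x. f' x v)"
    by auto
  have "\<forall>x\<in>S. ((\<lambda>x. L (f x)) has_derivative (\<lambda>v. L (f' x v))) (at x within S)"
    using f'(1) bounded_linear.has_derivative[OF assms(1)] by blast
  then show ?case
    unfolding Ck_on.simps using Suc.IH f'(2)
    by (intro exI[of _ "\<lambda>x v. L (f' x v)"]) auto
qed

lemma Ck_on_id: "Ck_on k S (\<lambda>x. x)"
proof (cases k)
  case (Suc j)
  then show ?thesis by (auto simp: Ck_on_const intro!: exI[of _ "\<lambda>x v. v"])
qed auto

lemma Ck_on_add: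
  assumes "Ck_on k S f" "Ck_on k S g"
  shows "Ck_on k S (\<lambda>x. f x + g x)"
  using assms
proof (induction k arbitrary: f g)
  case 0
  then show ?case by (auto intro: continuous_on_add)
next
  case (Suc k)
  obtain f' where f': "\<forall>x\<in>S. (f has_derivative f' x) (at x within S)"
    "\<forall>v. Ck_on k S (\<lambda>x. f' x v)"
    using Suc.prems by auto
  obtain g' where g': "\<forall>x\<in>S. (g has_derivative g' x) (at x within S)"
    "\<forall>v. Ck_on k S (\<lambda>x. g' x v)"
    using Suc.prems by auto
  show ?case
    unfolding Ck_on.simps using Suc.IH f' g'
    by (intro exI[of _ "\<lambda>x v. f' x v + g' x v"]) (auto intro: has_derivative_add)
qed

lemma Ck_on_mult:
  fixes f g :: "'a::real_normed_vector \<Rightarrow> real"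
  assumes "Ck_on k S f" "Ck_on k S g"
  shows "Ck_on k S (\<lambda>x. f x * g x)"
  using assms
proof (induction k arbitrary: f g)
  case 0
  then show ?case by (auto intro: continuous_on_mult)
next
  case (Suc k)
  obtain f' where f': "\<forall>x\<in>S. (f has_derivative f' x) (at x within S)"
    "\<forall>v. Ck_on k S (\<lambda>x. f' x v)"
    using Suc.prems by auto
  obtain g' where g': "\<forall>x\<in>S. (g has_derivative g' x) (at x within S)"
    "\<forall>v. Ck_on k S (\<lambda>x. g' x v)"
    using Suc.prems by auto
  have fg: "Ck_on k S f" "Ck_on k S g"
    using Suc.prems Ck_on_SucD by blast+
  show ?case
    unfolding Ck_on.simps
    using Suc.IH[OF fg(1)] Suc.IH[OF _ fg(2)] f' g'
    by (intro exI[of _ "\<lambda>x v. f x * g' x v + f' x v * g x"])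
       (auto intro!: has_derivative_mult Ck_on_add)
qed

lemma Ck_on_compose:
  fixes h :: "real \<Rightarrow> real" and g :: "'a::real_normed_vector \<Rightarrow> real"
  assumes "Ck_on k UNIV h" "Ck_on k S g"
  shows "Ck_on k S (\<lambda>x. h (g x))"
  using assms
proof (induction k arbitrary: h g)
  case 0
  then show ?case by (auto intro: continuous_on_compose2)
next
  case (Suc k)
  obtain h' where h': "\<And>x. (h has_derivative h' x) (at x)"
    "\<And>v. Ck_on k UNIV (\<lambda>x. h' x v)"
    using Suc.prems by auto
  obtain g' where g': "\<forall>x\<in>S. (g has_derivative g' x) (at x within S)"
    "\<forall>v. Ck_on k S (\<lambda>x. g' x v)"
    using Suc.prems by auto
  have g: "Ck_on k S g"
    using Suc.prems Ck_on_SucD by blast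
  have lin: "h' y v = h' y 1 * v" for y v
    using linear_cmul[OF has_derivative_linear[OF h'(1)[of y]], of v 1] by simp
  have "((\<lambda>x. h (g x)) has_derivative (\<lambda>v. h' (g x) 1 * g' x v)) (at x within S)"
    if "x \<in> S" for x
  proof -
    have "(g has_derivative g' x) (at x within S)"
      using g' that by blast
    then have "((\<lambda>x. h (g x)) has_derivative (\<lambda>v. h' (g x) (g' x v))) (at x within S)"
      using h'(1) has_derivative_compose by blast
    then show ?thesis
      by (subst (asm) lin)
  qed
  then show ?case
    unfolding Ck_on.simps
    using Suc.IH[OF h'(2) g] g'
    by (intro exI[of _ "\<lambda>x v. h' (g x) 1 * g' x v"]) (auto intro!: Ck_on_mult)
qed

lemma smooth_on_const: "smooth_on S (\<lambda>x. a)"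
  by (simp add: smooth_on_def Ck_on_const)

lemma smooth_on_bounded_linear:
  "bounded_linear L \<Longrightarrow> smooth_on S f \<Longrightarrow> smooth_on S (\<lambda>x. L (f x))"
  by (simp add: smooth_on_def Ck_on_bounded_linear)

lemma smooth_on_id: "smooth_on S (\<lambda>x. x)"
  by (simp add: smooth_on_def Ck_on_id)

lemma smooth_on_add: "smooth_on S f \<Longrightarrow> smooth_on S g \<Longrightarrow> smooth_on S (\<lambda>x. f x + g x)"
  by (simp add: smooth_on_def Ck_on_add)

lemma smooth_on_mult:
  fixes f g :: "'a::real_normed_vector \<Rightarrow> real"
  shows "smooth_on S f \<Longrightarrow> smooth_on S g \<Longrightarrow> smooth_on S (\<lambda>x. f x * g x)"
  by (simp add: smooth_on_def Ck_on_mult)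

lemma smooth_on_compose:
  fixes h :: "real \<Rightarrow> real" and g :: "'a::real_normed_vector \<Rightarrow> real"
  shows "smooth_on UNIV h \<Longrightarrow> smooth_on S g \<Longrightarrow> smooth_on S (\<lambda>x. h (g x))"
  by (simp add: smooth_on_def Ck_on_compose)

text \<open>
  Smoothness by coinduction: if derivatives never leave the family, they can be taken
  for ever.
\<close>
lemma smooth_on_derivative_closed_family:
  fixes F :: "(real \<Rightarrow> real) set"
  assumes closed: "\<And>f. f \<in> F \<Longrightarrow> \<exists>f'\<in>F. \<forall>x. (f has_real_derivative f' x) (at x)"
    and "f \<in> F"
  shows "smooth_on UNIV f"
proof -
  have "Ck_on k UNIV f" for k
    using \<open>f \<in> F\<close>
  proof (induction k arbitrary: f)
    case 0
    then obtain f' where "\<And>x. (f has_real_derivative f' x) (at x)"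
      using closed by blast
    then show ?case
      by (auto simp: continuous_on_eq_continuous_within intro: DERIV_isCont)
  next
    case (Suc k)
    then obtain f' where f': "f' \<in> F" "\<And>x. (f has_real_derivative f' x) (at x)"
      using closed by blast
    have "Ck_on k UNIV (\<lambda>x. f' x * v)" for v
      using Ck_on_bounded_linear[OF bounded_linear_mult_left] Suc.IH[OF f'(1)] by blast
    then show ?case
      using f'(2) by (auto simp: has_field_derivative_def intro!: exI[of _ "\<lambda>x v. f' x * v"])
  qed
  then show ?thesis by (simp add: smooth_on_def)
qed

lemma smooth_on_cos: "smooth_on UNIV (cos :: real \<Rightarrow> real)"
proof (rule smooth_on_derivative_closed_family)
  fix f :: "real \<Rightarrow> real"
  assume "f \<in> {cos, \<lambda>x. - sin x, \<lambda>x. - cos x, sin}"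
  then show "\<exists>f'\<in>{cos, \<lambda>x. - sin x, \<lambda>x. - cos x, sin}.
      \<forall>x. (f has_real_derivative f' x) (at x)"
    by (auto intro!: derivative_eq_intros)
qed auto

section \<open>Bump functions on the circle\<close>

text \<open>
  For \<open>p = 1\<close> this is the classical flat function \<open>exp (-1/x)\<close>. The polynomial factor in
  \<open>1/x\<close> makes the family closed under differentiation.
\<close>
definition flat_exp :: "real poly \<Rightarrow> real \<Rightarrow> real" where
  "flat_exp p x = (if x > 0 then poly p (1 / x) * exp (- (1 / x)) else 0)"

lemma poly_times_exp_tendsto_0:
  fixes p :: "real poly"
  shows "((\<lambda>y. poly p y * exp (- y)) \<longlongrightarrow> 0) at_top"
proof -
  have "((\<lambda>y. y ^ k * poly p y * exp (- y)) \<longlongrightarrow> 0) at_top" for k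
  proof (induction p arbitrary: k)
    case 0
    then show ?case by simp
  next
    case (pCons a p)
    have 1: "((\<lambda>y::real. y ^ k * exp (- y)) \<longlongrightarrow> 0) at_top"
      using tendsto_power_div_exp_0[of k] by (simp add: exp_minus field_simps)
    have "((\<lambda>y. a * (y ^ k * exp (- y)) + y ^ Suc k * poly p y * exp (- y)) \<longlongrightarrow> a * 0 + 0) at_top"
      by (intro tendsto_intros 1 pCons.IH)
    then show ?case by (simp add: algebra_simps)
  qed
  from this[of 0] show ?thesis by simp
qed

lemma flat_exp_tendsto_0: "(flat_exp p \<longlongrightarrow> 0) (at 0)"
proof (rule filterlim_split_at)
  show "(flat_exp p \<longlongrightarrow> 0) (at_left 0)"
    by (rule Lim_transform_eventually[of "\<lambda>x. 0"])
       (auto simp: flat_exp_def eventually_at_filter)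
  have "((\<lambda>x. poly p (inverse x) * exp (- inverse x)) \<longlongrightarrow> 0) (at_right 0)"
    by (rule filterlim_compose[OF poly_times_exp_tendsto_0 filterlim_inverse_at_top_right])
  then show "(flat_exp p \<longlongrightarrow> 0) (at_right 0)"
    by (rule Lim_transform_eventually)
       (auto simp: flat_exp_def eventually_at_filter divide_inverse)
qed

lemma DERIV_flat_exp:
  "(flat_exp p has_real_derivative flat_exp ([:0, 0, 1:] * (p - pderiv p)) x) (at x)"
proof -
  consider "x > 0" | "x < 0" | "x = 0" by linarith
  then show ?thesis
  proof cases
    case 1
    have "((\<lambda>x. poly p (1 / x) * exp (- (1 / x))) has_real_derivative
        flat_exp ([:0, 0, 1:] * (p - pderiv p)) x) (at x)"
      using 1
      by (auto simp: flat_exp_def field_simps power2_eq_square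
               intro!: derivative_eq_intros DERIV_chain2[OF poly_DERIV])
    then show ?thesis
      by (rule has_field_derivative_transform_within_open[of _ _ _ "{0<..}"])
        (use 1 in \<open>auto simp: flat_exp_def\<close>)
  next
    case 2
    have "((\<lambda>x. 0) has_real_derivative flat_exp ([:0, 0, 1:] * (p - pderiv p)) x) (at x)"
      using 2 by (auto simp: flat_exp_def)
    then show ?thesis
      by (rule has_field_derivative_transform_within_open[of _ _ _ "{..<0}"])
        (use 2 in \<open>auto simp: flat_exp_def\<close>)
  next
    case 3
    have "(\<lambda>h. (flat_exp p (0 + h) - flat_exp p 0) / h) = flat_exp (pCons 0 p)"
      by (auto simp: flat_exp_def fun_eq_iff)
    then show ?thesis
      using flat_exp_tendsto_0[of "pCons 0 p"] 3 by (simp add: DERIV_def flat_exp_def)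
  qed
qed

lemma smooth_on_flat_exp: "smooth_on UNIV (flat_exp p)"
  by (rule smooth_on_derivative_closed_family[of "range flat_exp"])
     (use DERIV_flat_exp in blast)+

lemma one_minus_cos_lower_bound:
  fixes r :: real
  assumes "0 \<le> r" "r \<le> 1"
  shows "r\<^sup>2 / 8 \<le> 1 - cos r"
proof (cases "r = 0")
  case False
  have "\<exists>\<xi>. 0 < \<xi> \<and> \<xi> < r/2 \<and> sin (r/2) - sin 0 = (r/2 - 0) * cos \<xi>"
    using False assms by (intro MVT2) (auto intro!: derivative_eq_intros)
  then obtain \<xi> where \<xi>: "0 < \<xi>" "\<xi> < r/2" "sin (r/2) = r/2 * cos \<xi>"
    by auto
  have "cos (pi/3) \<le> cos \<xi>"
    using \<xi> assms pi_gt3 by (intro cos_monotone_0_pi_le) auto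
  then have "r / 4 \<le> sin (r/2)"
    using \<xi>(3) assms mult_left_mono[of "1/2" "cos \<xi>" "r/2"] by (simp add: cos_60)
  then have "(r/4)\<^sup>2 \<le> (sin (r/2))\<^sup>2"
    using assms by (intro power_mono) auto
  moreover have "cos r = 1 - 2 * (sin (r/2))\<^sup>2"
    using cos_double_sin[of "r/2"] by simp
  ultimately show ?thesis by (simp add: power2_eq_square)
qed auto

text \<open>
  Bumps of width \<open>r\<close> and height \<open>1\<close> with slope of order \<open>1/r\<close>; what matters later is
  that the constant \<open>C\<close> is the same for all \<open>r\<close>. The flat function is composed with an affine
  function of \<open>cos x\<close>, so the bump is periodic and smooth from the start. It is supported where
  \<open>1 - cos x \<le> 1 - cos r\<close>; there \<open>(sin x)\<^sup>2 \<le> 2 * (1 - cos r)\<close>, and since \<open>1 - cos r\<close>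
  is of order \<open>r\<^sup>2\<close> the chain rule gives the slope.
\<close>
lemma circle_bump_family:
  obtains C :: real where "C > 0"
    "\<And>r. 0 < r \<Longrightarrow> r \<le> 1 \<Longrightarrow> \<exists>b b'. smooth_on UNIV b \<and> (\<forall>x. b (x + 2 * pi) = b x) \<and>
       (\<forall>x. (b has_real_derivative b' x) (at x)) \<and> continuous_on UNIV b' \<and>
       (\<forall>x. \<bar>b' x\<bar> \<le> C / r) \<and> b 0 = 1 \<and> (\<forall>x. 0 \<le> b x \<and> b x \<le> 1) \<and>
       (\<forall>x. r \<le> \<bar>x\<bar> \<longrightarrow> \<bar>x\<bar> \<le> 2 * pi - r \<longrightarrow> b x = 0 \<and> b' x = 0)"
proof -
  define h h' where "h = flat_exp 1" and "h' = flat_exp [:0, 0, 1:]"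
  have h: "(h has_real_derivative h' x) (at x)" for x
    using DERIV_flat_exp[of 1 x] by (simp add: h_def h'_def)
  have sh: "smooth_on UNIV h" and sh': "smooth_on UNIV h'"
    by (auto simp: h_def h'_def smooth_on_flat_exp)
  have ch': "continuous_on A h'" for A
    using smooth_on_imp_continuous_on[OF sh'] continuous_on_subset by blast
  have h0: "h x = 0" "h' x = 0" if "x \<le> 0" for x
    using that by (auto simp: h_def h'_def flat_exp_def)
  have h_range: "0 \<le> h x" "x \<le> 1 \<Longrightarrow> h x \<le> h 1" for x
    by (auto simp: h_def flat_exp_def field_simps)
  have h1: "h 1 > 0" by (simp add: h_def flat_exp_def)
  have "bounded (h' ` {0..1})"
    by (intro compact_imp_bounded compact_continuous_image ch') auto
  then obtain M where M: "M > 0" "\<And>x. x \<in> {0..1} \<Longrightarrow> \<bar>h' x\<bar> \<le> M"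
    unfolding bounded_pos by auto
  define C where "C = M * 4 / h 1"
  have "C > 0" using M h1 by (simp add: C_def)
  moreover
  {
    fix r :: real
    assume r: "0 < r" "r \<le> 1"
    define R where "R = 1 - cos r"
    have "0 < r\<^sup>2 / 8" using r by simp
    moreover have "r\<^sup>2 / 8 \<le> R"
      unfolding R_def using one_minus_cos_lower_bound r by simp
    ultimately have R: "r\<^sup>2 / 8 \<le> R" "R > 0" by linarith+
    define w where "w x = 1 - (1 - cos x) / R" for x :: real
    define b where "b x = h (w x) / h 1" for x
    define b' where "b' x = h' (w x) * (- sin x / R) / h 1" for x
    have w1: "w x \<le> 1" for x using R by (simp add: w_def)
    have w_eq: "w = (\<lambda>x. (1 - 1 / R) + (1 / R) * cos x)"
      by (auto simp: w_def fun_eq_iff diff_divide_distrib)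
    have "smooth_on UNIV w"
      unfolding w_eq by (intro smooth_on_add smooth_on_mult smooth_on_const smooth_on_cos)
    then have "smooth_on UNIV (\<lambda>x. h (w x))"
      by (rule smooth_on_compose[OF sh])
    then have "smooth_on UNIV b"
      unfolding b_def by (rule smooth_on_bounded_linear[OF bounded_linear_divide])
    moreover have "b (x + 2 * pi) = b x" for x
      by (simp add: b_def w_def)
    moreover have "(b has_real_derivative b' x) (at x)" for x
    proof -
      have "(w has_real_derivative (- sin x / R)) (at x)"
        unfolding w_def using R by (auto intro!: derivative_eq_intros)
      from DERIV_chain2[OF h this] show ?thesis
        unfolding b_def b'_def using h1 by (auto intro!: derivative_eq_intros)
    qed
    moreover have "continuous_on UNIV b'"
      unfolding b'_def w_def using R h1
      by (intro continuous_intros continuous_on_compose2[OF ch']) auto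
    moreover have "\<bar>b' x\<bar> \<le> C / r" for x
    proof (cases "w x \<le> 0")
      case True
      then show ?thesis using h0 r \<open>C > 0\<close> by (simp add: b'_def)
    next
      case False
      then have "1 - cos x \<le> R" using R by (simp add: w_def field_simps)
      have "(sin x)\<^sup>2 = (1 - cos x) * (1 + cos x)"
        by (simp add: sin_squared_eq algebra_simps power2_eq_square)
      also have "\<dots> \<le> R * 2"
        using \<open>1 - cos x \<le> R\<close> R cos_ge_minus_one[of x] cos_le_one[of x]
        by (intro mult_mono) linarith+
      finally have "(sin x)\<^sup>2 \<le> 2 * R" by simp
      then have "(r * sin x)\<^sup>2 \<le> r\<^sup>2 * (2 * R)"
        by (simp add: power_mult_distrib mult_left_mono)
      also have "\<dots> \<le> (8 * R) * (2 * R)"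
        using R by (intro mult_right_mono) auto
      also have "\<dots> = (4 * R)\<^sup>2" by (simp add: power2_eq_square)
      finally have "\<bar>r * sin x\<bar> \<le> 4 * R"
        using R abs_le_square_iff[of "r * sin x" "4 * R"] by simp
      then have "\<bar>sin x\<bar> / R \<le> 4 / r"
        using r R by (simp add: abs_mult field_simps)
      moreover have "\<bar>h' (w x)\<bar> \<le> M"
        using M(2)[of "w x"] False w1[of x] by auto
      ultimately have "\<bar>h' (w x)\<bar> * (\<bar>sin x\<bar> / R) / h 1 \<le> M * (4 / r) / h 1"
        using M h1 R r by (intro divide_right_mono mult_mono) auto
      then show ?thesis
        using R h1 r by (simp add: b'_def C_def abs_mult mult.commute[of "h 1"])
    qed
    moreover have "b 0 = 1" using h1 by (simp add: b_def w_def)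
    moreover have "0 \<le> b x \<and> b x \<le> 1" for x
      using h_range w1 h1 by (auto simp: b_def)
    moreover have "b x = 0 \<and> b' x = 0" if "r \<le> \<bar>x\<bar>" "\<bar>x\<bar> \<le> 2 * pi - r" for x
    proof -
      have "cos \<bar>x\<bar> \<le> cos r"
      proof (cases "\<bar>x\<bar> \<le> pi")
        case True
        then show ?thesis using r that by (intro cos_monotone_0_pi_le) auto
      next
        case False
        have "cos (2 * pi - \<bar>x\<bar>) \<le> cos r"
          using r that False by (intro cos_monotone_0_pi_le) auto
        then show ?thesis by (simp add: cos_diff)
      qed
      then have "w x \<le> 0" using R by (simp add: w_def R_def field_simps)
      then show ?thesis using h0 by (simp add: b_def b'_def)
    qed
    ultimately have "\<exists>b b'. smooth_on UNIV b \<and> (\<forall>x. b (x + 2 * pi) = b x) \<and>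
       (\<forall>x. (b has_real_derivative b' x) (at x)) \<and> continuous_on UNIV b' \<and>
       (\<forall>x. \<bar>b' x\<bar> \<le> C / r) \<and> b 0 = 1 \<and> (\<forall>x. 0 \<le> b x \<and> b x \<le> 1) \<and>
       (\<forall>x. r \<le> \<bar>x\<bar> \<longrightarrow> \<bar>x\<bar> \<le> 2 * pi - r \<longrightarrow> b x = 0 \<and> b' x = 0)"
      by blast
  }
  ultimately show ?thesis using that by blast
qed

section \<open>Kinematics of a path of immersions\<close>

definition tangent :: "(real \<Rightarrow> real \<Rightarrow> complex) \<Rightarrow> real \<Rightarrow> real \<Rightarrow> complex" where
  "tangent c t \<theta> = vector_derivative (c t) (at \<theta>)"

text \<open>
  The cross product of velocity and tangent, that is, the Jacobian determinant of
  \<open>(t, \<theta>) \<mapsto> c t \<theta>\<close>: the signed area swept out per unit of \<open>t\<close> and \<open>\<theta>\<close>. Only the normal part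
  of the velocity contributes to it.
\<close>
definition sweep :: "(real \<Rightarrow> real \<Rightarrow> complex) \<Rightarrow> real \<Rightarrow> real \<Rightarrow> real" where
  "sweep c t \<theta> = Im (cnj (velocity c t \<theta>) * tangent c t \<theta>)"

lemma has_derivative_strip_partials:
  fixes f :: "real \<times> real \<Rightarrow> 'a::real_normed_vector"
  assumes f: "(f has_derivative F) (at (t, \<theta>) within {0..1} \<times> UNIV)" and t: "t \<in> {0..1}"
  shows "((\<lambda>s. f (s, \<theta>)) has_vector_derivative F (1, 0)) (at t within {0..1})"
    and "((\<lambda>\<eta>. f (t, \<eta>)) has_vector_derivative F (0, 1)) (at \<theta>)"
proof -
  have lin: "F (h *\<^sub>R v) = h *\<^sub>R F v" for h v
    using linear_cmul[OF has_derivative_linear[OF f]] .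
  have "((\<lambda>s. f (s, \<theta>)) has_derivative (\<lambda>h. F (h, 0))) (at t within {0..1})"
  proof (rule has_derivative_in_compose[of "\<lambda>s. (s, \<theta>)" "\<lambda>h. (h, 0)" t "{0..1}" f F])
    show "(f has_derivative F) (at (t, \<theta>) within (\<lambda>s. (s, \<theta>)) ` {0..1})"
      by (rule has_derivative_subset[OF f]) auto
  qed (intro has_derivative_Pair has_derivative_ident has_derivative_const)
  then show "((\<lambda>s. f (s, \<theta>)) has_vector_derivative F (1, 0)) (at t within {0..1})"
    unfolding has_vector_derivative_def using lin[of h "(1, 0)" for h, symmetric]
    by (simp only: scaleR_Pair real_scaleR_def mult_1_right mult_zero_right)
  have "((\<lambda>\<eta>. f (t, \<eta>)) has_derivative (\<lambda>h. F (0, h))) (at \<theta>)"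
  proof (rule has_derivative_in_compose[of "\<lambda>\<eta>. (t, \<eta>)" "\<lambda>h. (0, h)" \<theta> UNIV f F])
    show "(f has_derivative F) (at (t, \<theta>) within (\<lambda>\<eta>. (t, \<eta>)) ` UNIV)"
      by (rule has_derivative_subset[OF f]) (use t in auto)
  qed (intro has_derivative_Pair has_derivative_ident has_derivative_const)
  then show "((\<lambda>\<eta>. f (t, \<eta>)) has_vector_derivative F (0, 1)) (at \<theta>)"
    unfolding has_vector_derivative_def using lin[of h "(0, 1)" for h, symmetric]
    by (simp only: scaleR_Pair real_scaleR_def mult_1_right mult_zero_right)
qed

text \<open>
  Smoothness on the strip is stated through an unnamed total derivative \<open>F\<close>. Its two
  columns are the partial derivatives \<^const>\<open>velocity\<close> and \<^const>\<open>tangent\<close>, and they inherit its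
  regularity.
\<close>
lemma imm_path_Ck:
  assumes "imm_path c"
  obtains F :: "real \<times> real \<Rightarrow> real \<times> real \<Rightarrow> complex" where
    "\<And>t \<theta>. t \<in> {0..1} \<Longrightarrow>
       ((\<lambda>s. c s \<theta>) has_vector_derivative F (t, \<theta>) (1, 0)) (at t within {0..1})"
    "\<And>t \<theta>. t \<in> {0..1} \<Longrightarrow> (c t has_vector_derivative F (t, \<theta>) (0, 1)) (at \<theta>)"
    "\<And>v. Ck_on (Suc 0) ({0..1} \<times> UNIV) (\<lambda>x. F x v)"
    "\<And>t \<theta>. t \<in> {0..1} \<Longrightarrow> velocity c t \<theta> = F (t, \<theta>) (1, 0)"
    "\<And>t \<theta>. t \<in> {0..1} \<Longrightarrow> tangent c t \<theta> = F (t, \<theta>) (0, 1)"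
proof -
  have "Ck_on (Suc (Suc 0)) ({0..1} \<times> UNIV) (\<lambda>(t, \<theta>). c t \<theta>)"
    using assms unfolding imm_path_def smooth_on_def by blast
  then obtain F where F: "\<And>x. x \<in> {0..1} \<times> UNIV \<Longrightarrow>
      ((\<lambda>(t, \<theta>). c t \<theta>) has_derivative F x) (at x within {0..1} \<times> UNIV)"
    "\<And>v. Ck_on (Suc 0) ({0..1} \<times> UNIV) (\<lambda>x. F x v)"
    unfolding Ck_on.simps(2)[of "Suc 0"] by blast
  have 1: "((\<lambda>s. c s \<theta>) has_vector_derivative F (t, \<theta>) (1, 0)) (at t within {0..1})"
    and 2: "(c t has_vector_derivative F (t, \<theta>) (0, 1)) (at \<theta>)" if "t \<in> {0..1}" for t \<theta>
    using has_derivative_strip_partials[OF F(1) that] that by auto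
  show ?thesis
  proof (rule that[of F])
    show "velocity c t \<theta> = F (t, \<theta>) (1, 0)" if "t \<in> {0..1}" for t \<theta>
      unfolding velocity_def
      by (rule vector_derivative_within_closed_interval[OF _ that 1[OF that]]) simp
    show "tangent c t \<theta> = F (t, \<theta>) (0, 1)" if "t \<in> {0..1}" for t \<theta>
      unfolding tangent_def by (rule vector_derivative_at[OF 2[OF that]])
  qed (use 1 2 F in auto)
qed

lemma imm_path_has_velocity:
  assumes "imm_path c" "t \<in> {0..1}"
  shows "((\<lambda>s. c s \<theta>) has_vector_derivative velocity c t \<theta>) (at t within {0..1})"
  by (rule imm_path_Ck[OF assms(1)]) (metis assms(2))

lemma imm_path_has_tangent:
  assumes "imm_path c" "t \<in> {0..1}"
  shows "(c t has_vector_derivative tangent c t \<theta>) (at \<theta>)"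
  by (rule imm_path_Ck[OF assms(1)]) (metis assms(2))

lemma continuous_on_velocity:
  assumes "imm_path c"
  shows "continuous_on ({0..1} \<times> UNIV) (\<lambda>x. velocity c (fst x) (snd x))"
proof -
  obtain F where F: "\<And>v. Ck_on (Suc 0) ({0..1} \<times> UNIV) (\<lambda>x. F x v)"
    "\<And>t \<theta>. t \<in> {0..1} \<Longrightarrow> velocity c t \<theta> = F (t, \<theta>) (1, 0)"
    by (rule imm_path_Ck[OF assms]; rule that; assumption)
  have "continuous_on ({0..1} \<times> UNIV) (\<lambda>x. F x (1, 0))"
    using Ck_on_SucD[OF F(1)] by simp
  then show ?thesis
    by (rule continuous_on_eq) (auto simp: F(2))
qed

lemma continuous_on_tangent:
  assumes "imm_path c"
  shows "continuous_on ({0..1} \<times> UNIV) (\<lambda>x. tangent c (fst x) (snd x))"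
proof -
  obtain F where F: "\<And>v. Ck_on (Suc 0) ({0..1} \<times> UNIV) (\<lambda>x. F x v)"
    "\<And>t \<theta>. t \<in> {0..1} \<Longrightarrow> tangent c t \<theta> = F (t, \<theta>) (0, 1)"
    by (rule imm_path_Ck[OF assms]; rule that; assumption)
  have "continuous_on ({0..1} \<times> UNIV) (\<lambda>x. F x (0, 1))"
    using Ck_on_SucD[OF F(1)] by simp
  then show ?thesis
    by (rule continuous_on_eq) (auto simp: F(2))
qed

lemma velocity_has_theta_derivative:
  assumes "imm_path c"
  obtains w where "continuous_on ({0..1} \<times> UNIV) (\<lambda>x. w (fst x) (snd x))"
    "\<And>t \<theta>. t \<in> {0..1} \<Longrightarrow> (velocity c t has_vector_derivative w t \<theta>) (at \<theta>)"
proof -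
  obtain F where F: "\<And>v. Ck_on (Suc 0) ({0..1} \<times> UNIV) (\<lambda>x. F x v)"
    "\<And>t \<theta>. t \<in> {0..1} \<Longrightarrow> velocity c t \<theta> = F (t, \<theta>) (1, 0)"
    by (rule imm_path_Ck[OF assms]; rule that; assumption)
  obtain G where G: "\<And>x. x \<in> {0..1} \<times> UNIV \<Longrightarrow>
      ((\<lambda>x. F x (1, 0)) has_derivative G x) (at x within {0..1} \<times> UNIV)"
    "\<And>v. continuous_on ({0..1} \<times> UNIV) (\<lambda>x. G x v)"
    using F(1)[of "(1, 0)"] by auto
  show ?thesis
  proof (rule that[of "\<lambda>t \<theta>. G (t, \<theta>) (0, 1)"])
    show "continuous_on ({0..1} \<times> UNIV) (\<lambda>x. G (fst x, snd x) (0, 1))"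
      using G(2) by simp
    show "(velocity c t has_vector_derivative G (t, \<theta>) (0, 1)) (at \<theta>)" if "t \<in> {0..1}" for t \<theta>
    proof -
      have "velocity c t = (\<lambda>\<eta>. F (t, \<eta>) (1, 0))"
        using F(2) that by blast
      then show ?thesis
        using has_derivative_strip_partials(2)[OF G(1) that] that by auto
    qed
  qed
qed

lemma continuous_on_strip_compose:
  fixes f :: "real \<Rightarrow> real \<Rightarrow> 'a::topological_space"
  assumes "continuous_on ({0..1} \<times> UNIV) (\<lambda>x. f (fst x) (snd x))"
    and "continuous_on A g" "continuous_on A h" "\<And>x. x \<in> A \<Longrightarrow> g x \<in> {0..1}"
  shows "continuous_on A (\<lambda>x. f (g x) (h x))"
proof -
  have "continuous_on A ((\<lambda>x. f (fst x) (snd x)) \<circ> (\<lambda>x. (g x, h x)))"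
    using assms by (intro continuous_on_compose continuous_on_Pair)
      (auto elim!: continuous_on_subset)
  then show ?thesis by (simp add: o_def)
qed

lemmas continuous_on_velocity_compose [continuous_intros] =
  continuous_on_strip_compose[OF continuous_on_velocity]

lemmas continuous_on_tangent_compose [continuous_intros] =
  continuous_on_strip_compose[OF continuous_on_tangent]

lemma continuous_on_sweep_compose [continuous_intros]:
  assumes "imm_path c" "continuous_on A g" "continuous_on A h" "\<And>x. x \<in> A \<Longrightarrow> g x \<in> {0..1}"
  shows "continuous_on A (\<lambda>x. sweep c (g x) (h x))"
  unfolding sweep_def by (intro continuous_intros assms)

lemma tangent_nonzero: "imm_path c \<Longrightarrow> t \<in> {0..1} \<Longrightarrow> tangent c t \<theta> \<noteq> 0"
  by (auto simp: imm_path_def Imm_def tangent_def)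

lemma imm_path_periodic: "imm_path c \<Longrightarrow> t \<in> {0..1} \<Longrightarrow> c t (\<theta> + 2 * pi) = c t \<theta>"
  by (auto simp: imm_path_def Imm_def)

lemma tangent_periodic:
  assumes "imm_path c" "t \<in> {0..1}"
  shows "tangent c t (\<theta> + 2 * pi) = tangent c t \<theta>"
proof -
  have "((\<lambda>x. x + 2 * pi) has_vector_derivative 1) (at \<theta>)"
    by (auto intro!: derivative_eq_intros)
  then have "((c t \<circ> (\<lambda>x. x + 2 * pi)) has_vector_derivative 1 *\<^sub>R tangent c t (\<theta> + 2 * pi)) (at \<theta>)"
    by (rule vector_diff_chain_at) (rule imm_path_has_tangent[OF assms])
  moreover have "c t \<circ> (\<lambda>x. x + 2 * pi) = c t"
    using imm_path_periodic[OF assms] by auto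
  ultimately show ?thesis
    using vector_derivative_at[of "c t" "tangent c t (\<theta> + 2 * pi)" \<theta>] by (simp add: tangent_def)
qed

lemma velocity_periodic:
  assumes "imm_path c" "t \<in> {0..1}"
  shows "velocity c t (\<theta> + 2 * pi) = velocity c t \<theta>"
proof -
  have "((\<lambda>s. c s \<theta>) has_vector_derivative velocity c t (\<theta> + 2 * pi)) (at t within {0..1})"
    using imm_path_has_velocity[OF assms, of "\<theta> + 2 * pi"]
    by (rule has_vector_derivative_transform[rotated 2])
       (use assms imm_path_periodic[OF assms(1)] in auto)
  from vector_derivative_within_closed_interval[OF _ assms(2) this]
  show ?thesis by (simp add: velocity_def)
qed

lemma sweep_periodic:
  "imm_path c \<Longrightarrow> t \<in> {0..1} \<Longrightarrow> sweep c t (\<theta> + 2 * pi) = sweep c t \<theta>"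
  by (simp add: sweep_def tangent_periodic velocity_periodic)

lemma periodic_representative:
  fixes f :: "real \<Rightarrow> 'a"
  assumes "\<And>x. f (x + 2 * pi) = f x"
  obtains y where "y \<in> {0..2 * pi}" "f y = f x"
proof -
  have shift: "f (x + of_int n * (2 * pi)) = f x" for n :: int and x
  proof (induction n rule: int_induct[where k = 0])
    case (step1 i)
    then show ?case using assms[of "x + of_int i * (2 * pi)"] by (simp add: algebra_simps)
  next
    case (step2 i)
    then show ?case using assms[of "x + of_int (i - 1) * (2 * pi)"] by (simp add: algebra_simps)
  qed simp
  define n where "n = \<lfloor>x / (2 * pi)\<rfloor>"
  have "of_int n \<le> x / (2 * pi)" "x / (2 * pi) < of_int n + 1"
    unfolding n_def by linarith+
  then have "x + of_int (- n) * (2 * pi) \<in> {0..2 * pi}"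
    by (simp add: field_simps)
  then show ?thesis using that shift by blast
qed

text \<open>
  The minus sign comes from \<open>n\<close> being the tangent turned by a positive right angle: a
  counterclockwise curve shrinks when it moves along \<open>n\<close>.
\<close>
lemma velocity_inner_unit_normal:
  assumes "tangent c t \<theta> \<noteq> 0"
  shows "velocity c t \<theta> \<bullet> unit_normal (c t) \<theta> = - sweep c t \<theta> / norm (tangent c t \<theta>)"
  using assms unfolding unit_normal_def sweep_def inner_complex_def tangent_def[symmetric]
  by (simp add: Re_divide_of_real Im_divide_of_real field_simps)

lemma norm_unit_normal: "tangent c t \<theta> \<noteq> 0 \<Longrightarrow> norm (unit_normal (c t) \<theta>) = 1"
  by (simp add: unit_normal_def tangent_def norm_divide norm_mult)

lemma norm_normal_velocity:
  assumes "tangent c t \<theta> \<noteq> 0"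
  shows "norm (normal_velocity c t \<theta>) = \<bar>sweep c t \<theta>\<bar> / norm (tangent c t \<theta>)"
  by (simp add: normal_velocity_def norm_unit_normal velocity_inner_unit_normal assms)

definition sweep_energy :: "(real \<Rightarrow> real \<Rightarrow> complex) \<Rightarrow> real \<Rightarrow> real" where
  "sweep_energy c t = integral {0..2 * pi} (\<lambda>\<theta>. (sweep c t \<theta>)\<^sup>2 / norm (tangent c t \<theta>))"

lemma speed_eq:
  assumes "imm_path c" "t \<in> {0..1}"
  shows "speed (\<lambda>l. l) c t = sqrt (curve_length (c t) * sweep_energy c t)"
proof -
  have "(normal_velocity c t \<theta> \<bullet> normal_velocity c t \<theta>) * norm (tangent c t \<theta>)
      = (sweep c t \<theta>)\<^sup>2 / norm (tangent c t \<theta>)" for \<theta>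
    using norm_normal_velocity[of c t \<theta>] tangent_nonzero[OF assms, of \<theta>]
    by (simp add: dot_square_norm power_divide power2_eq_square)
  then show ?thesis
    by (simp add: speed_def metric_G_def sweep_energy_def tangent_def)
qed

lemma continuous_on_curve_length:
  assumes "imm_path c"
  shows "continuous_on {0..1} (\<lambda>t. curve_length (c t))"
proof -
  have "continuous_on ({0..1} \<times> cbox 0 (2 * pi)) (\<lambda>(t, \<theta>). norm (tangent c t \<theta>))"
    unfolding split_beta by (intro continuous_intros assms) auto
  from integral_continuous_on_param[OF this] show ?thesis
    by (simp add: curve_length_def tangent_def)
qed

lemma continuous_on_sweep_energy:
  assumes "imm_path c"
  shows "continuous_on {0..1} (sweep_energy c)"
proof -
  have "continuous_on ({0..1} \<times> cbox 0 (2 * pi))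
      (\<lambda>(t, \<theta>). (sweep c t \<theta>)\<^sup>2 / norm (tangent c t \<theta>))"
    unfolding split_beta by (intro continuous_intros assms) (auto simp: tangent_nonzero[OF assms])
  from integral_continuous_on_param[OF this] show ?thesis
    by (simp add: sweep_energy_def[abs_def])
qed

lemma continuous_on_speed:
  assumes "imm_path c"
  shows "continuous_on {0..1} (speed (\<lambda>l. l) c)"
proof -
  have "continuous_on {0..1} (\<lambda>t. sqrt (curve_length (c t) * sweep_energy c t))"
    by (intro continuous_intros continuous_on_curve_length continuous_on_sweep_energy assms)
  then show ?thesis
    by (rule continuous_on_eq) (simp add: speed_eq[OF assms])
qed

lemma curve_length_pos:
  assumes "imm_path c" "t \<in> {0..1}"
  shows "curve_length (c t) > 0"
proof -
  have cont: "continuous_on {0..2 * pi} (\<lambda>\<theta>. norm (tangent c t \<theta>))"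
    using assms by (intro continuous_intros) auto
  have "curve_length (c t) \<ge> 0"
    unfolding curve_length_def tangent_def[symmetric] by (intro integral_nonneg integrable_continuous_real cont) auto
  moreover have "curve_length (c t) \<noteq> 0"
    using integral_eq_0_iff[OF cont] tangent_nonzero[OF assms, of 0]
    by (force simp: curve_length_def tangent_def)
  ultimately show ?thesis by simp
qed

lemma sweep_energy_nonneg:
  assumes "imm_path c" "t \<in> {0..1}"
  shows "sweep_energy c t \<ge> 0"
  unfolding sweep_energy_def using assms
  by (intro integral_nonneg integrable_continuous_real continuous_intros)
     (auto simp: tangent_nonzero)

lemma path_length_constant_speed:
  assumes "\<And>t. t \<in> {0..1} \<Longrightarrow> speed \<phi> c t = v"
  shows "path_length_G \<phi> c = v"
proof -
  have "(speed \<phi> c has_integral v) {0..1}"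
    by (rule has_integral_eq[of _ "\<lambda>t. v"])
       (use assms has_integral_const_real[of v 0 1] in auto)
  then show ?thesis by (simp add: path_length_G_def integral_unique)
qed

section \<open>The enclosed area\<close>

text \<open>
  Symmetry of the mixed second derivatives, with one-sided derivatives in time at the ends of
  the interval. The position is the time integral of the velocity, and differentiating it under
  the integral sign shows that the tangent is the time integral of \<open>w\<close>.
\<close>
lemma tangent_has_time_derivative:
  assumes c: "imm_path c"
    and w: "continuous_on ({0..1} \<times> UNIV) (\<lambda>x. w (fst x) (snd x))"
      "\<And>t \<theta>. t \<in> {0..1} \<Longrightarrow> (velocity c t has_vector_derivative w t \<theta>) (at \<theta>)"
    and t: "t \<in> {0..1}"
  shows "((\<lambda>s. tangent c s \<theta>) has_vector_derivative w t \<theta>) (at t within {0..1})"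
proof -
  have tangent_eq: "tangent c 0 \<theta> + integral {0..r} (\<lambda>s. w s \<theta>) = tangent c r \<theta>"
    if r: "r \<in> {0..1}" for r
  proof -
    have "((\<lambda>s. velocity c s \<eta>) has_integral (c r \<eta> - c 0 \<eta>)) {0..r}" for \<eta>
      using r
      by (intro fundamental_theorem_of_calculus
          has_vector_derivative_within_subset[OF imm_path_has_velocity[OF c]]) auto
    from this[THEN integral_unique]
    have c_eq: "c r = (\<lambda>\<eta>. c 0 \<eta> + integral (cbox 0 r) (\<lambda>s. velocity c s \<eta>))"
      by (simp add: fun_eq_iff)
    have "((\<lambda>\<eta>. integral (cbox 0 r) (\<lambda>s. velocity c s \<eta>))
        has_vector_derivative integral (cbox 0 r) (\<lambda>s. w s \<theta>)) (at \<theta> within UNIV)"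
    proof (rule leibniz_rule_vector_derivative)
      show "(\<lambda>s. velocity c s \<eta>) integrable_on cbox 0 r" for \<eta>
        using r by (intro integrable_continuous continuous_intros c) auto
      show "continuous_on (UNIV \<times> cbox 0 r) (\<lambda>(\<eta>, s). w s \<eta>)"
        unfolding split_beta using r
        by (intro continuous_on_strip_compose[OF w(1)] continuous_intros) auto
    qed (use w(2) r in auto)
    then have "(c r has_vector_derivative (tangent c 0 \<theta> + integral {0..r} (\<lambda>s. w s \<theta>))) (at \<theta>)"
      unfolding c_eq using imm_path_has_tangent[OF c, of 0 \<theta>]
      by (auto intro!: has_vector_derivative_add)
    then show ?thesis
      using imm_path_has_tangent[OF c r] vector_derivative_unique_at by blast
  qed
  have "continuous_on {0..1} (\<lambda>s. w s \<theta>)"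
    by (intro continuous_on_strip_compose[OF w(1)] continuous_intros) auto
  from integral_has_vector_derivative[OF this t]
  have "((\<lambda>r. tangent c 0 \<theta> + integral {0..r} (\<lambda>s. w s \<theta>)) has_vector_derivative (0 + w t \<theta>))
      (at t within {0..1})"
    by (intro has_vector_derivative_add has_vector_derivative_const)
  then have "((\<lambda>r. tangent c 0 \<theta> + integral {0..r} (\<lambda>s. w s \<theta>)) has_vector_derivative w t \<theta>)
      (at t within {0..1})"
    by simp
  then show ?thesis
    by (rule has_vector_derivative_transform[OF t, rotated]) (simp add: tangent_eq)
qed

text \<open>
  Green's formula for the enclosed area, each point of the plane being counted with its
  winding number.
\<close>
definition signed_area :: "(real \<Rightarrow> complex) \<Rightarrow> real" where
  "signed_area \<gamma> =
     integral {0..2 * pi} (\<lambda>\<theta>. Im (cnj (\<gamma> \<theta>) * vector_derivative \<gamma> (at \<theta>))) / 2"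

lemma has_vector_derivative_Im_cnj_mult:
  assumes "(f has_vector_derivative f') (at x within S)"
    and "(g has_vector_derivative g') (at x within S)"
  shows "((\<lambda>x. Im (cnj (f x) * g x)) has_vector_derivative Im (cnj (f x) * g') + Im (cnj f' * g x))
    (at x within S)"
  using bounded_linear.has_vector_derivative[OF bounded_linear_Im
      has_vector_derivative_mult[OF bounded_linear.has_vector_derivative[OF bounded_linear_cnj assms(1)] assms(2)]]
  by simp

text \<open>
  Differentiation under the integral gives two terms; integration by parts in \<open>\<theta>\<close>, without
  boundary terms by periodicity, turns the one that contains the mixed derivative into the
  other. Their sum is twice the swept area, which cancels the factor \<open>1/2\<close> of Green's formula.
\<close>
lemma signed_area_has_derivative:
  assumes c: "imm_path c" and t: "t \<in> {0..1}"
  shows "((\<lambda>s. signed_area (c s)) has_vector_derivative integral {0..2 * pi} (sweep c t))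
    (at t within {0..1})"
proof -
  obtain w where w: "continuous_on ({0..1} \<times> UNIV) (\<lambda>x. w (fst x) (snd x))"
    "\<And>t \<theta>. t \<in> {0..1} \<Longrightarrow> (velocity c t has_vector_derivative w t \<theta>) (at \<theta>)"
    by (rule velocity_has_theta_derivative[OF c]; rule that; assumption)
  have cc: "continuous_on ({0..1} \<times> UNIV) (\<lambda>x. c (fst x) (snd x))"
    using c smooth_on_imp_continuous_on[of _ "\<lambda>(t, \<theta>). c t \<theta>"]
    by (simp add: imm_path_def split_beta)
  note [continuous_intros] = continuous_on_strip_compose[OF w(1)] continuous_on_strip_compose[OF cc]
  define fx where "fx t \<theta> = Im (cnj (c t \<theta>) * w t \<theta>) + Im (cnj (velocity c t \<theta>) * tangent c t \<theta>)"
    for t \<theta>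
  have "((\<lambda>t. integral (cbox 0 (2 * pi)) (\<lambda>\<theta>. Im (cnj (c t \<theta>) * tangent c t \<theta>)))
      has_vector_derivative integral (cbox 0 (2 * pi)) (fx t)) (at t within {0..1})"
  proof (rule leibniz_rule_vector_derivative)
    show "((\<lambda>s. Im (cnj (c s \<theta>) * tangent c s \<theta>)) has_vector_derivative fx s \<theta>) (at s within {0..1})"
      if "s \<in> {0..1}" for s \<theta>
      unfolding fx_def
      by (rule has_vector_derivative_Im_cnj_mult[OF imm_path_has_velocity[OF c that]
            tangent_has_time_derivative[OF c w that]])
    show "(\<lambda>\<theta>. Im (cnj (c s \<theta>) * tangent c s \<theta>)) integrable_on cbox 0 (2 * pi)"
      if "s \<in> {0..1}" for s
      using that by (intro integrable_continuous continuous_intros c) auto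
    show "continuous_on ({0..1} \<times> cbox 0 (2 * pi)) (\<lambda>(t, \<theta>). fx t \<theta>)"
      unfolding split_beta fx_def by (intro continuous_intros c) auto
  qed (use t in auto)
  then have 1: "((\<lambda>s. signed_area (c s)) has_vector_derivative
      integral {0..2 * pi} (fx t) / 2) (at t within {0..1})"
    unfolding signed_area_def tangent_def[symmetric]
    by (intro bounded_linear.has_vector_derivative[OF bounded_linear_divide]) simp
  have "((\<lambda>\<theta>. fx t \<theta> - 2 * sweep c t \<theta>) has_integral
      (Im (cnj (c t (2 * pi)) * velocity c t (2 * pi)) - Im (cnj (c t 0) * velocity c t 0))) {0..2 * pi}"
  proof (rule fundamental_theorem_of_calculus)
    fix \<theta> :: real
    have "((\<lambda>\<theta>. Im (cnj (c t \<theta>) * velocity c t \<theta>)) has_vector_derivative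
       Im (cnj (c t \<theta>) * w t \<theta>) + Im (cnj (tangent c t \<theta>) * velocity c t \<theta>)) (at \<theta>)"
      by (rule has_vector_derivative_Im_cnj_mult[OF imm_path_has_tangent[OF c t] w(2)[OF t]])
    moreover have "Im (cnj (c t \<theta>) * w t \<theta>) + Im (cnj (tangent c t \<theta>) * velocity c t \<theta>)
        = fx t \<theta> - 2 * sweep c t \<theta>"
      by (simp add: fx_def sweep_def)
    ultimately show "((\<lambda>\<theta>. Im (cnj (c t \<theta>) * velocity c t \<theta>)) has_vector_derivative
        fx t \<theta> - 2 * sweep c t \<theta>) (at \<theta> within {0..2 * pi})"
      using has_vector_derivative_at_within by metis
  qed simp
  moreover have "velocity c t (2 * pi) = velocity c t 0" "c t (2 * pi) = c t 0"
    using velocity_periodic[OF c t, of 0] imm_path_periodic[OF c t, of 0] by simp_all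
  ultimately have "integral {0..2 * pi} (\<lambda>\<theta>. fx t \<theta> - 2 * sweep c t \<theta>) = 0"
    by (simp add: integral_unique)
  moreover have "fx t integrable_on {0..2 * pi}" "sweep c t integrable_on {0..2 * pi}"
    unfolding fx_def using t c by (auto intro!: integrable_continuous_real continuous_intros)
  ultimately have "integral {0..2 * pi} (fx t) = 2 * integral {0..2 * pi} (sweep c t)"
    by (simp add: integral_diff integrable_on_cmult_left)
  then show ?thesis using 1 by simp
qed

lemma signed_area_difference:
  assumes "imm_path c"
  shows "((\<lambda>t. integral {0..2 * pi} (sweep c t)) has_integral
    (signed_area (c 1) - signed_area (c 0))) {0..1}"
  using signed_area_has_derivative[OF assms]
  by (intro fundamental_theorem_of_calculus) auto

lemma smooth_on_UNIV_has_derivative: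
  fixes f :: "real \<Rightarrow> 'a::real_normed_vector"
  assumes "smooth_on UNIV f"
  obtains f' where "\<And>x. (f has_vector_derivative f' x) (at x)" "continuous_on UNIV f'"
proof -
  have "Ck_on (Suc 0) UNIV f" using assms by (simp add: smooth_on_def)
  then obtain F where F: "\<And>x. (f has_derivative F x) (at x)" "\<And>v. continuous_on UNIV (\<lambda>x. F x v)"
    by auto
  have "(f has_vector_derivative F x 1) (at x)" for x
    using F(1)[of x] linear_cmul[OF has_derivative_linear[OF F(1)[of x]], of h 1 for h, symmetric]
    by (simp only: has_vector_derivative_def real_scaleR_def mult_1_right)
  then show ?thesis by (rule that[OF _ F(2)])
qed

text \<open>
  Both sides are increments over one period of the same antiderivative of \<open>f\<close>, and for
  periodic \<open>f\<close> such an increment does not depend on the starting point.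
\<close>
lemma periodic_integral_substitution:
  fixes f :: "real \<Rightarrow> real"
  assumes f: "continuous_on UNIV f" "\<And>x. f (x + 2 * pi) = f x"
    and \<phi>: "\<And>x. (\<phi> has_real_derivative \<phi>' x) (at x)" "\<And>x. 0 \<le> \<phi>' x" "\<phi> (2 * pi) = \<phi> 0 + 2 * pi"
  shows "((\<lambda>x. f (\<phi> x) * \<phi>' x) has_integral integral {0..2 * pi} f) {0..2 * pi}"
proof -
  \<comment> \<open>Starting the antiderivative strictly below both \<open>0\<close> and \<open>\<phi> 0\<close> makes it differentiable, from
    both sides, at all points that occur.\<close>
  define a where "a = min 0 (\<phi> 0) - 1"
  define G where "G u = integral {a..u} f" for u
  have G: "(G has_vector_derivative f x) (at x)" if "a < x" for x
  proof -
    have "continuous_on {a..x + 1} f"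
      using f(1) continuous_on_subset by blast
    then have "(G has_vector_derivative f x) (at x within {a..x + 1})"
      unfolding G_def by (rule integral_has_vector_derivative) (use that in auto)
    then show ?thesis
      using that by (simp add: at_within_Icc_at)
  qed
  have mono: "\<phi> x \<le> \<phi> y" if "x \<le> y" for x y
    using DERIV_nonneg_imp_nondecreasing[OF that] \<phi> by blast
  have "((\<lambda>x. f (\<phi> x) * \<phi>' x) has_integral (G (\<phi> (2 * pi)) - G (\<phi> 0))) {0..2 * pi}"
  proof (rule fundamental_theorem_of_calculus)
    fix x :: real assume "x \<in> {0..2 * pi}"
    then have "a < \<phi> x" using mono[of 0 x] by (auto simp: a_def)
    then have "((G \<circ> \<phi>) has_vector_derivative \<phi>' x *\<^sub>R f (\<phi> x)) (at x)"
      using \<phi>(1) by (intro vector_diff_chain_at G)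
        (auto simp: has_real_derivative_iff_has_vector_derivative)
    then show "((\<lambda>x. G (\<phi> x)) has_vector_derivative f (\<phi> x) * \<phi>' x) (at x within {0..2 * pi})"
      by (auto simp: o_def mult.commute intro: has_vector_derivative_at_within)
  qed simp
  moreover have "G (\<phi> 0 + 2 * pi) - G (\<phi> 0) = G (0 + 2 * pi) - G 0"
  proof (rule has_derivative_zero_unique[of "{a<..}" "\<lambda>x. G (x + 2 * pi) - G x"])
    fix x assume "x \<in> {a<..}"
    then have x: "a < x" "a < x + 2 * pi" using pi_gt_zero by (auto intro: less_trans)
    have "((\<lambda>x. x + 2 * pi) has_vector_derivative 1) (at x)"
      by (auto intro!: derivative_eq_intros)
    from vector_diff_chain_at[OF this G[OF x(2)]]
    have "((\<lambda>x. G (x + 2 * pi) - G x) has_vector_derivative f (x + 2 * pi) - f x) (at x)"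
      by (intro has_vector_derivative_diff G x) (simp add: o_def)
    then show "((\<lambda>x. G (x + 2 * pi) - G x) has_derivative (\<lambda>h. 0)) (at x within {a<..})"
      by (auto simp: f(2) has_vector_derivative_def intro: has_derivative_at_withinI)
  qed (auto simp: a_def)
  moreover have "(f has_integral (G (2 * pi) - G 0)) {0..2 * pi}"
    by (rule fundamental_theorem_of_calculus)
       (auto simp: a_def intro!: has_vector_derivative_at_within G)
  ultimately show ?thesis
    using \<phi>(3) by (simp add: integral_unique)
qed

lemma signed_area_reparam:
  assumes \<gamma>: "\<gamma> \<in> Imm" and \<phi>: "\<phi> \<in> Diff_S1"
  shows "signed_area (\<gamma> \<circ> \<phi>) = signed_area \<gamma>"
proof -
  have smooth: "smooth_on UNIV \<gamma>" "smooth_on UNIV \<phi>"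
    and per: "\<And>\<theta>. \<gamma> (\<theta> + 2 * pi) = \<gamma> \<theta>"
    and \<phi>_per: "\<And>\<theta>. \<phi> (\<theta> + 2 * pi) = \<phi> \<theta> + 2 * pi"
    and \<phi>_pos: "\<And>\<theta>. deriv \<phi> \<theta> > 0"
    using assms by (auto simp: Imm_def Diff_S1_def)
  obtain \<gamma>' where \<gamma>': "\<And>x. (\<gamma> has_vector_derivative \<gamma>' x) (at x)" "continuous_on UNIV \<gamma>'"
    using smooth_on_UNIV_has_derivative[OF smooth(1)] by blast
  obtain \<phi>' where \<phi>': "\<And>x. (\<phi> has_vector_derivative \<phi>' x) (at x)"
    using smooth_on_UNIV_has_derivative[OF smooth(2)] by blast
  have D\<phi>: "(\<phi> has_real_derivative \<phi>' x) (at x)" for x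
    using \<phi>' by (simp add: has_real_derivative_iff_has_vector_derivative)
  have \<phi>'_pos: "0 \<le> \<phi>' x" for x
    using \<phi>_pos[of x] DERIV_imp_deriv[OF D\<phi>] by simp
  have \<gamma>'_per: "\<gamma>' (x + 2 * pi) = \<gamma>' x" for x
  proof -
    have "((\<lambda>x. x + 2 * pi) has_vector_derivative 1) (at x)"
      by (auto intro!: derivative_eq_intros)
    from vector_diff_chain_at[OF this \<gamma>'(1)]
    have "(\<gamma> has_vector_derivative \<gamma>' (x + 2 * pi)) (at x)"
      by (simp add: o_def per)
    then show ?thesis using \<gamma>'(1) vector_derivative_unique_at by blast
  qed
  define f where "f x = Im (cnj (\<gamma> x) * \<gamma>' x)" for x
  have "continuous_on UNIV f"
    unfolding f_def
    by (intro continuous_intros \<gamma>'(2) smooth_on_imp_continuous_on smooth)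
  then have "((\<lambda>x. f (\<phi> x) * \<phi>' x) has_integral integral {0..2 * pi} f) {0..2 * pi}"
    by (rule periodic_integral_substitution)
       (use \<phi>_per[of 0] in \<open>auto simp: f_def per \<gamma>'_per D\<phi> \<phi>'_pos\<close>)
  moreover have "vector_derivative (\<gamma> \<circ> \<phi>) (at x) = \<phi>' x *\<^sub>R \<gamma>' (\<phi> x)" for x
    by (rule vector_derivative_at) (rule vector_diff_chain_at[OF \<phi>' \<gamma>'(1)])
  then have "Im (cnj ((\<gamma> \<circ> \<phi>) x) * vector_derivative (\<gamma> \<circ> \<phi>) (at x)) = f (\<phi> x) * \<phi>' x" for x
    by (simp add: f_def algebra_simps)
  moreover have "f = (\<lambda>x. Im (cnj (\<gamma> x) * vector_derivative \<gamma> (at x)))"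
    using vector_derivative_at[OF \<gamma>'(1)] by (simp add: f_def fun_eq_iff)
  ultimately show ?thesis
    unfolding signed_area_def by (simp only: integral_unique)
qed

lemma id_in_Diff_S1: "(\<lambda>x. x) \<in> Diff_S1"
  by (simp add: Diff_S1_def smooth_on_id)

text \<open>
  The area descends to the quotient because reparametrizations preserve orientation.
\<close>
lemma signed_area_eq_if_proj_eq:
  assumes "proj_B_i \<gamma> = proj_B_i \<delta>" "\<gamma> \<in> Imm" "\<delta> \<in> Imm"
  shows "signed_area \<gamma> = signed_area \<delta>"
proof -
  have "\<delta> \<in> proj_B_i \<delta>"
    using assms(3) id_in_Diff_S1 by (force simp: proj_B_i_def reparam_rel_def o_def)
  then have "(\<gamma>, \<delta>) \<in> reparam_rel"
    using assms(1) by (auto simp: proj_B_i_def)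
  then obtain \<phi> where "\<phi> \<in> Diff_S1" "\<delta> = \<gamma> \<circ> \<phi>"
    by (auto simp: reparam_rel_def)
  then show ?thesis using signed_area_reparam[OF assms(2)] by simp
qed

text \<open>
  Cauchy-Schwarz. With \<open>J\<close> for the sweep, \<open>p\<close> for the norm of the tangent and
  \<open>\<lambda> = (\<integral> J) / \<ell>\<close>, it is the expansion of \<open>\<integral> (J - \<lambda> p)\<^sup>2 / p \<ge> 0\<close>.
\<close>
lemma swept_area_le_speed:
  assumes "imm_path c" "t \<in> {0..1}"
  shows "\<bar>integral {0..2 * pi} (sweep c t)\<bar> \<le> speed (\<lambda>l. l) c t"
proof -
  define S l E where "S = integral {0..2 * pi} (sweep c t)" and "l = curve_length (c t)"
    and "E = sweep_energy c t"
  have l: "l > 0" using curve_length_pos[OF assms] by (simp add: l_def)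
  have nz: "tangent c t \<theta> \<noteq> 0" for \<theta> using tangent_nonzero[OF assms] .
  define p where "p \<theta> = norm (tangent c t \<theta>)" for \<theta>
  have int: "sweep c t integrable_on {0..2 * pi}"
    "p integrable_on {0..2 * pi}"
    "(\<lambda>\<theta>. (sweep c t \<theta>)\<^sup>2 / p \<theta>) integrable_on {0..2 * pi}"
    unfolding p_def using assms nz
    by (auto intro!: integrable_continuous_real continuous_intros)
  have "((\<lambda>\<theta>. (sweep c t \<theta>)\<^sup>2 / p \<theta> - 2 * (S / l) * sweep c t \<theta> + (S / l)\<^sup>2 * p \<theta>) has_integral
      E - 2 * (S / l) * S + (S / l)\<^sup>2 * l) {0..2 * pi}"
    using int[THEN integrable_integral]
    unfolding E_def sweep_energy_def S_def l_def curve_length_def tangent_def[symmetric] p_def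
    by (intro has_integral_add has_integral_diff has_integral_mult_right)
  then have "0 \<le> E - 2 * (S / l) * S + (S / l)\<^sup>2 * l"
  proof (rule has_integral_nonneg)
    fix \<theta>
    have "x\<^sup>2 / y - 2 * k * x + k\<^sup>2 * y = (x - k * y)\<^sup>2 / y" if "y \<noteq> 0" for x y k :: real
      using that by (simp add: power2_eq_square field_simps)
    from this[of "p \<theta>" "sweep c t \<theta>" "S / l"]
    have "(sweep c t \<theta>)\<^sup>2 / p \<theta> - 2 * (S / l) * sweep c t \<theta> + (S / l)\<^sup>2 * p \<theta>
        = (sweep c t \<theta> - (S / l) * p \<theta>)\<^sup>2 / p \<theta>"
      using nz[of \<theta>] by (simp add: p_def)
    also have "\<dots> \<ge> 0" by (simp add: p_def)
    finally show "0 \<le> (sweep c t \<theta>)\<^sup>2 / p \<theta> - 2 * (S / l) * sweep c t \<theta> + (S / l)\<^sup>2 * p \<theta>" .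
  qed
  then have "S\<^sup>2 \<le> l * E"
    using l by (simp add: power2_eq_square field_simps)
  then have "\<bar>S\<bar> \<le> sqrt (l * E)"
    by (simp add: real_le_rsqrt)
  then show ?thesis
    by (simp add: speed_eq[OF assms] S_def l_def E_def)
qed

text \<open>
  The lower bound for all competitors: it depends on the path only through its ends.
\<close>
lemma area_difference_le_path_length:
  assumes "imm_path c"
  shows "\<bar>signed_area (c 1) - signed_area (c 0)\<bar> \<le> path_length_G (\<lambda>l. l) c"
proof -
  note area = signed_area_difference[OF assms]
  have "norm (integral {0..1} (\<lambda>t. integral {0..2 * pi} (sweep c t)))
      \<le> integral {0..1} (speed (\<lambda>l. l) c)"
    using area continuous_on_speed[OF assms] swept_area_le_speed[OF assms]
    by (intro integral_norm_bound_integral) (auto intro: integrable_continuous_real)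
  then show ?thesis
    using integral_unique[OF area] by (simp add: path_length_G_def)
qed

lemma path_length_eq_dist_iff:
  assumes "imm_path c"
  shows "ereal (path_length_G \<phi> c) = dist_G \<phi> (proj_B_i (c 0)) (proj_B_i (c 1)) \<longleftrightarrow>
    (\<forall>d. connects d (proj_B_i (c 0)) (proj_B_i (c 1)) \<longrightarrow> path_length_G \<phi> c \<le> path_length_G \<phi> d)"
    (is "?l = ?D \<longleftrightarrow> _")
proof -
  have "connects c (proj_B_i (c 0)) (proj_B_i (c 1))"
    using assms by (simp add: connects_def)
  then have "?D \<le> ?l"
    unfolding dist_G_def by (auto intro: INF_lower)
  then have "?l = ?D \<longleftrightarrow> ?l \<le> ?D" by auto
  also have "\<dots> \<longleftrightarrow> (\<forall>d. connects d (proj_B_i (c 0)) (proj_B_i (c 1)) \<longrightarrow>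
      path_length_G \<phi> c \<le> path_length_G \<phi> d)"
    unfolding dist_G_def by (simp add: le_INF_iff)
  finally show ?thesis .
qed

text \<open>
  Along such a path the signed normal speed times the length takes only the values \<open>K\<close> and
  \<open>-K\<close>, hence one of them by continuity and connectedness. So nothing cancels in the swept area,
  Cauchy-Schwarz is an equality at each time, and the path attains the lower bound
  \<open>area_difference_le_path_length\<close>, which is the same for every path with these ends.
\<close>
lemma uniform_normal_speed_imp_minimal_geodesic:
  assumes c: "imm_path c"
    and K: "\<And>t \<theta>. t \<in> {0..1} \<Longrightarrow> norm (normal_velocity c t \<theta>) * curve_length (c t) = K"
  shows "minimal_geodesic (\<lambda>l. l) c"
proof -
  define q where "q x = sweep c (fst x) (snd x) / norm (tangent c (fst x) (snd x)) *
     curve_length (c (fst x))" for x :: "real \<times> real"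
  have abs_q: "\<bar>q (t, \<theta>)\<bar> = K" if "t \<in> {0..1}" for t \<theta>
    using K[OF that, of \<theta>] curve_length_pos[OF c that]
      norm_normal_velocity[of c t \<theta>] tangent_nonzero[OF c that, of \<theta>]
    by (simp add: q_def abs_mult)
  have "continuous_on ({0..1} \<times> UNIV) q"
    unfolding q_def using tangent_nonzero[OF c]
    by (intro continuous_intros c continuous_on_compose2[OF continuous_on_curve_length[OF c]]) auto
  moreover have "connected ({0..1::real} \<times> (UNIV :: real set))"
    by (intro connected_Times) auto
  moreover have "q x \<in> {K, -K}" if "x \<in> {0..1} \<times> UNIV" for x
    using abs_q[of "fst x" "snd x"] that by (auto simp: abs_if split: if_splits)
  then have "q ` ({0..1} \<times> UNIV) \<subseteq> {K, -K}" by blast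
  then have "finite (q ` ({0..1} \<times> UNIV))"
    using finite_subset by blast
  ultimately have "q constant_on ({0..1} \<times> UNIV)"
    by (intro continuous_finite_range_constant)
  then obtain w where w: "\<And>t \<theta>. t \<in> {0..1} \<Longrightarrow> q (t, \<theta>) = w"
    by (auto simp: constant_on_def)
  have sweep_eq: "sweep c t \<theta> = w / curve_length (c t) * norm (tangent c t \<theta>)"
    if "t \<in> {0..1}" for t \<theta>
    using w[OF that, of \<theta>] curve_length_pos[OF c that] tangent_nonzero[OF c that, of \<theta>]
    by (auto simp: q_def field_simps)
  have len: "((\<lambda>\<theta>. norm (tangent c t \<theta>)) has_integral curve_length (c t)) {0..2 * pi}"
    if "t \<in> {0..1}" for t
    unfolding curve_length_def tangent_def[symmetric] using c that
    by (intro integrable_integral integrable_continuous_real continuous_intros) auto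
  have area: "integral {0..2 * pi} (sweep c t) = w" if "t \<in> {0..1}" for t
  proof -
    have "((\<lambda>\<theta>. w / curve_length (c t) * norm (tangent c t \<theta>)) has_integral
        w / curve_length (c t) * curve_length (c t)) {0..2 * pi}"
      by (rule has_integral_mult_right[OF len[OF that]])
    then have "(sweep c t has_integral w / curve_length (c t) * curve_length (c t)) {0..2 * pi}"
      by (rule has_integral_eq[rotated]) (simp add: sweep_eq[OF that])
    then have "(sweep c t has_integral w) {0..2 * pi}"
      using curve_length_pos[OF c that] by simp
    then show ?thesis by (rule integral_unique)
  qed
  have speed: "speed (\<lambda>l. l) c t = \<bar>w\<bar>" if "t \<in> {0..1}" for t
  proof -
    have "(sweep c t \<theta>)\<^sup>2 / norm (tangent c t \<theta>)
        = (w / curve_length (c t))\<^sup>2 * norm (tangent c t \<theta>)" for \<theta>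
      using tangent_nonzero[OF c that, of \<theta>] by (simp add: sweep_eq[OF that] power2_eq_square)
    then have "sweep_energy c t = (w / curve_length (c t))\<^sup>2 * curve_length (c t)"
      unfolding sweep_energy_def using integral_unique[OF len[OF that]] by simp
    then have "curve_length (c t) * sweep_energy c t = w\<^sup>2"
      using curve_length_pos[OF c that] by (simp add: power2_eq_square)
    then show ?thesis by (simp add: speed_eq[OF c that])
  qed
  have "((\<lambda>t. integral {0..2 * pi} (sweep c t)) has_integral w) {0..1}"
    by (rule has_integral_eq[of _ "\<lambda>t. w"])
       (use area has_integral_const_real[of w 0 1] in auto)
  then have "signed_area (c 1) - signed_area (c 0) = w"
    using signed_area_difference[OF c] has_integral_unique by blast
  moreover have len_c: "path_length_G (\<lambda>l. l) c = \<bar>w\<bar>"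
    using path_length_constant_speed speed by blast
  moreover have "signed_area (d 0) = signed_area (c 0)" "signed_area (d 1) = signed_area (c 1)"
    if "connects d (proj_B_i (c 0)) (proj_B_i (c 1))" for d
    using that c by (auto simp: connects_def imm_path_def intro!: signed_area_eq_if_proj_eq)
  ultimately have "\<forall>d. connects d (proj_B_i (c 0)) (proj_B_i (c 1)) \<longrightarrow>
      path_length_G (\<lambda>l. l) c \<le> path_length_G (\<lambda>l. l) d"
    using area_difference_le_path_length by (metis connects_def)
  then show ?thesis
    using path_length_eq_dist_iff[OF c] c speed unfolding minimal_geodesic_def by blast
qed

section \<open>Shortening a path where the normal speed is large\<close>

text \<open>
  The speed \<open>sqrt (\<ell> * E)\<close> is not an integral over \<open>\<theta>\<close>, which hampers local variations. By the
  inequality between arithmetic and geometric means, \<open>sqrt (\<ell> * E) \<le> (\<mu> * \<ell> + E / \<mu>) / 2\<close> for every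
  \<open>\<mu> > 0\<close>, and the right-hand side is half the integral of this density, evaluated at the velocity
  \<open>A\<close> and the tangent \<open>B\<close>. Equality holds for \<open>\<mu> = sqrt (E / \<ell>)\<close>.
\<close>
definition action_density :: "real \<Rightarrow> complex \<Rightarrow> complex \<Rightarrow> real" where
  "action_density \<mu> A B = \<mu> * norm B + (Im (cnj A * B))\<^sup>2 / (\<mu> * norm B)"

lemma integral_density:
  assumes c: "imm_path c" and t: "t \<in> {0..1}"
  shows "((\<lambda>\<theta>. action_density \<mu> (velocity c t \<theta>) (tangent c t \<theta>)) has_integral
    (\<mu> * curve_length (c t) + sweep_energy c t / \<mu>)) {0..2 * pi}"
proof -
  have "((\<lambda>\<theta>. norm (tangent c t \<theta>)) has_integral curve_length (c t)) {0..2 * pi}"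
    unfolding curve_length_def tangent_def[symmetric] using c t
    by (intro integrable_integral integrable_continuous_real continuous_intros) auto
  moreover have "((\<lambda>\<theta>. (sweep c t \<theta>)\<^sup>2 / norm (tangent c t \<theta>)) has_integral sweep_energy c t)
      {0..2 * pi}"
    unfolding sweep_energy_def using c t tangent_nonzero[OF c t]
    by (intro integrable_integral integrable_continuous_real continuous_intros) auto
  ultimately have "((\<lambda>\<theta>. \<mu> * norm (tangent c t \<theta>) + (sweep c t \<theta>)\<^sup>2 / norm (tangent c t \<theta>) / \<mu>)
      has_integral (\<mu> * curve_length (c t) + sweep_energy c t / \<mu>)) {0..2 * pi}"
    by (intro has_integral_add has_integral_mult_right has_integral_divide)
  then show ?thesis
    by (simp add: action_density_def sweep_def mult.commute)
qed

lemma speed_le_integral_density: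
  assumes c: "imm_path c" and t: "t \<in> {0..1}" and "\<mu> > 0"
  shows "speed (\<lambda>l. l) c t \<le> (\<mu> * curve_length (c t) + sweep_energy c t / \<mu>) / 2"
proof -
  have "sqrt ((\<mu> * curve_length (c t)) * (sweep_energy c t / \<mu>))
      \<le> (\<mu> * curve_length (c t) + sweep_energy c t / \<mu>) / 2"
    using assms curve_length_pos[OF c t] sweep_energy_nonneg[OF c t]
    by (intro arith_geo_mean_sqrt) auto
  then show ?thesis
    using \<open>\<mu> > 0\<close> by (simp add: speed_eq[OF c t])
qed

text \<open>
  With \<open>J = Im (cnj A * B)\<close> held fixed, the density \<open>\<mu> p + J\<^sup>2 / (\<mu> p)\<close> decreases in
  \<open>p = norm B\<close> as long as \<open>p < \<bar>J\<bar> / \<mu>\<close>, so at a point that moves faster than \<open>\<mu>\<close> it pays to make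
  the curve longer. Tilting the tangent by \<open>x\<close> in the normal direction \<open>n\<close> increases \<open>p\<^sup>2\<close> by
  \<open>x\<^sup>2\<close>. It leaves \<open>J\<close> unchanged if the velocity is corrected by \<open>- \<beta> x\<close>, where \<open>\<beta>\<close> cancels the
  tangential part of \<open>A\<close>.
\<close>
lemma density_decreases_at_point:
  fixes A B :: complex
  assumes B: "B \<noteq> 0" and \<mu>: "\<mu> > 0" and fast: "(Im (cnj A * B))\<^sup>2 > (\<mu> * norm B)\<^sup>2"
  obtains n :: complex and \<beta> \<eta> \<nu> :: real where "\<eta> > 0" "\<nu> > 0"
    "\<And>x. \<bar>x\<bar> \<le> \<eta> \<Longrightarrow> B + x *\<^sub>R n \<noteq> 0 \<and>
       action_density \<mu> (A + (- \<beta> * x) *\<^sub>R n) (B + x *\<^sub>R n) - action_density \<mu> A B \<le> - \<nu> * x\<^sup>2"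
proof -
  define p J where "p = norm B" and "J = Im (cnj A * B)"
  have p: "p > 0" using B by (simp add: p_def)
  have J: "J\<^sup>2 > \<mu>\<^sup>2 * p\<^sup>2" using fast by (simp add: p_def J_def power_mult_distrib)
  \<comment> \<open>In units of \<open>B\<close> the real part of the velocity is tangential and the imaginary part normal.\<close>
  define w where "w = A / B"
  have A: "A = w * B" using B by (simp add: w_def)
  have BB: "cnj B * B = complex_of_real (p\<^sup>2)"
    by (simp add: p_def complex_norm_square[symmetric] mult.commute)
  have J_w: "J = - Im w * p\<^sup>2"
  proof -
    have "cnj A * B = cnj w * (cnj B * B)" by (simp add: A)
    then show ?thesis unfolding J_def BB by simp
  qed
  define n \<beta> where "n = \<i> * B / of_real p" and "\<beta> = - Re w"
  \<comment> \<open>Any length strictly between \<open>p\<close> and the point \<open>J\<^sup>2 / (\<mu>\<^sup>2 p)\<close>, where the gain is used up,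
    would do; \<open>\<eta>\<close> is the tilt that produces it.\<close>
  define p1 where "p1 = (p + J\<^sup>2 / (\<mu>\<^sup>2 * p)) / 2"
  have mid: "x < (x + y) / 2 \<and> (x + y) / 2 < y" if "x < y" for x y :: real
    using that by simp
  have "p < J\<^sup>2 / (\<mu>\<^sup>2 * p)"
    using J p \<mu> by (simp add: field_simps power2_eq_square)
  then have p1: "p < p1" "p1 < J\<^sup>2 / (\<mu>\<^sup>2 * p)"
    using mid unfolding p1_def by blast+
  define \<eta> where "\<eta> = sqrt (p1\<^sup>2 - p\<^sup>2)"
  have "p\<^sup>2 < p1\<^sup>2" using p p1 by (intro power_strict_mono) auto
  then have \<eta>: "\<eta> > 0" "\<eta>\<^sup>2 = p1\<^sup>2 - p\<^sup>2" by (simp_all add: \<eta>_def)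
  define m where "m = J\<^sup>2 / (\<mu> * p * p1) - \<mu>"
  have m: "m > 0"
    using p1 p \<mu> by (simp add: m_def field_simps power2_eq_square)
  define \<nu> where "\<nu> = m / (p1 + p)"
  have "\<nu> > 0" using m p p1 by (simp add: \<nu>_def)
  moreover have "B + x *\<^sub>R n \<noteq> 0 \<and>
       action_density \<mu> (A + (- \<beta> * x) *\<^sub>R n) (B + x *\<^sub>R n) - action_density \<mu> A B \<le> - \<nu> * x\<^sup>2"
    if x: "\<bar>x\<bar> \<le> \<eta>" for x
  proof -
    define P where "P = sqrt (p\<^sup>2 + x\<^sup>2)"
    have Bx: "B + x *\<^sub>R n = B * Complex 1 (x / p)"
      by (simp add: n_def complex_eq_iff field_simps)
    have "p\<^sup>2 + x\<^sup>2 = p\<^sup>2 * (1 + (x / p)\<^sup>2)"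
      using p by (simp add: field_simps power2_eq_square)
    then have "P = p * norm (Complex 1 (x / p))"
      using p by (simp add: P_def real_sqrt_mult cmod_def)
    then have norm_Bx: "norm (B + x *\<^sub>R n) = P"
      using p unfolding Bx by (simp add: norm_mult p_def[symmetric])
    have "A + (- \<beta> * x) *\<^sub>R n = B * (w + Complex 0 (x * Re w / p))"
      by (simp add: A n_def \<beta>_def complex_eq_iff field_simps)
    then have "cnj (A + (- \<beta> * x) *\<^sub>R n) * (B + x *\<^sub>R n) =
       (cnj B * B) * (cnj (w + Complex 0 (x * Re w / p)) * Complex 1 (x / p))"
      unfolding Bx by simp
    then have J_Bx: "Im (cnj (A + (- \<beta> * x) *\<^sub>R n) * (B + x *\<^sub>R n)) = J"
      unfolding BB J_w by (simp add: algebra_simps)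
    have "x\<^sup>2 \<le> \<eta>\<^sup>2" using x \<eta> abs_le_square_iff[of x \<eta>] by simp
    then have "p\<^sup>2 + x\<^sup>2 \<le> p1\<^sup>2" using \<eta> by simp
    then have P1: "P \<le> p1" unfolding P_def using p p1 by (intro real_le_lsqrt) auto
    have P0: "p \<le> P" unfolding P_def by (rule real_le_rsqrt) simp
    have P2: "P\<^sup>2 = p\<^sup>2 + x\<^sup>2" by (simp add: P_def)
    have "action_density \<mu> (A + (- \<beta> * x) *\<^sub>R n) (B + x *\<^sub>R n) - action_density \<mu> A B
        = (\<mu> * P + J\<^sup>2 / (\<mu> * P)) - (\<mu> * p + J\<^sup>2 / (\<mu> * p))"
      unfolding action_density_def norm_Bx J_Bx p_def[symmetric] J_def[symmetric] by simp
    also have "\<dots> = - (P - p) * (J\<^sup>2 / (\<mu> * p * P) - \<mu>)"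
      using P0 p \<mu> by (simp add: field_simps)
    also have "\<dots> \<le> - (P - p) * m"
    proof -
      have "J\<^sup>2 / (\<mu> * p * p1) \<le> J\<^sup>2 / (\<mu> * p * P)"
        using P0 P1 p \<mu> by (intro divide_left_mono mult_left_mono) auto
      then have "(P - p) * m \<le> (P - p) * (J\<^sup>2 / (\<mu> * p * P) - \<mu>)"
        using P0 by (intro mult_left_mono) (auto simp: m_def)
      then show ?thesis by (simp only: mult_minus_left neg_le_iff_le)
    qed
    also have "\<dots> \<le> - \<nu> * x\<^sup>2"
    proof -
      have "x\<^sup>2 = (P - p) * (P + p)" using P2 by (simp add: power2_eq_square algebra_simps)
      also have "\<dots> \<le> (P - p) * (p1 + p)" using P0 P1 by (intro mult_left_mono) auto
      finally have "\<nu> * x\<^sup>2 \<le> \<nu> * ((P - p) * (p1 + p))"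
        using \<open>\<nu> > 0\<close> by (intro mult_left_mono) auto
      also have "\<dots> = (P - p) * m" using p p1 by (simp add: \<nu>_def)
      finally show ?thesis by (simp only: mult_minus_left neg_le_iff_le)
    qed
    finally show ?thesis using norm_Bx P0 p by auto
  qed
  ultimately show ?thesis using \<eta>(1) that by blast
qed

text \<open>
  The estimate at one point persists nearby up to an error \<open>\<kappa>\<close>, uniformly in the tilt \<open>x\<close>:
  this is the tube lemma for the compact range \<open>[-\<eta>, \<eta>]\<close> of \<open>x\<close>. The further variable \<open>z\<close> admits a small
  deviation of the velocity from the exact correction \<open>- \<beta> x\<close>.
\<close>
lemma density_decreases_near_point:
  assumes c: "imm_path c" and t0: "0 < t0" "t0 < 1"
    and \<mu>: "continuous_on {0..1} \<mu>" "\<And>t. t \<in> {0..1} \<Longrightarrow> \<mu> t > 0"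
    and fast: "(sweep c t0 \<theta>0)\<^sup>2 > (\<mu> t0 * norm (tangent c t0 \<theta>0))\<^sup>2"
  shows "\<exists>(n :: complex) \<beta> \<eta> \<nu>. \<eta> > 0 \<and> \<nu> > 0 \<and>
    (\<forall>\<kappa>>0. \<exists>\<delta>>0. \<forall>t \<theta> x z. \<bar>t - t0\<bar> < \<delta> \<longrightarrow> \<bar>\<theta> - \<theta>0\<bar> < \<delta> \<longrightarrow> \<bar>z\<bar> < \<delta> \<longrightarrow> \<bar>x\<bar> \<le> \<eta> \<longrightarrow>
       tangent c t \<theta> + x *\<^sub>R n \<noteq> 0 \<and>
       action_density (\<mu> t) (velocity c t \<theta> + (z - \<beta> * x) *\<^sub>R n) (tangent c t \<theta> + x *\<^sub>R n)
         - action_density (\<mu> t) (velocity c t \<theta>) (tangent c t \<theta>) \<le> \<kappa> - \<nu> * x\<^sup>2)"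
proof -
  have t0': "t0 \<in> {0..1}" using t0 by simp
  obtain n \<beta> \<eta> \<nu> where *: "\<eta> > 0" "\<nu> > 0"
    "\<And>x. \<bar>x\<bar> \<le> \<eta> \<Longrightarrow> tangent c t0 \<theta>0 + x *\<^sub>R n \<noteq> 0 \<and>
       action_density (\<mu> t0) (velocity c t0 \<theta>0 + (- \<beta> * x) *\<^sub>R n) (tangent c t0 \<theta>0 + x *\<^sub>R n)
         - action_density (\<mu> t0) (velocity c t0 \<theta>0) (tangent c t0 \<theta>0) \<le> - \<nu> * x\<^sup>2"
    using density_decreases_at_point[OF tangent_nonzero[OF c t0'] \<mu>(2)[OF t0'] fast[unfolded sweep_def]]
    by metis
  have "\<exists>\<delta>>0. \<forall>t \<theta> x z. \<bar>t - t0\<bar> < \<delta> \<longrightarrow> \<bar>\<theta> - \<theta>0\<bar> < \<delta> \<longrightarrow> \<bar>z\<bar> < \<delta> \<longrightarrow> \<bar>x\<bar> \<le> \<eta> \<longrightarrow>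
       tangent c t \<theta> + x *\<^sub>R n \<noteq> 0 \<and>
       action_density (\<mu> t) (velocity c t \<theta> + (z - \<beta> * x) *\<^sub>R n) (tangent c t \<theta> + x *\<^sub>R n)
         - action_density (\<mu> t) (velocity c t \<theta>) (tangent c t \<theta>) \<le> \<kappa> - \<nu> * x\<^sup>2" if "\<kappa> > 0" for \<kappa>
  proof -
    \<comment> \<open>Points are \<open>((t, \<theta>, z), x)\<close>.\<close>
    define S where "S = ({0<..<1::real} \<times> (UNIV :: (real \<times> real) set)) \<times> (UNIV :: real set)"
    define B where "B = (\<lambda>q :: (real \<times> real \<times> real) \<times> real.
      tangent c (fst (fst q)) (fst (snd (fst q))) + snd q *\<^sub>R n)"
    define G where "G = (\<lambda>q :: (real \<times> real \<times> real) \<times> real.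
      action_density (\<mu> (fst (fst q)))
        (velocity c (fst (fst q)) (fst (snd (fst q))) + (snd (snd (fst q)) - \<beta> * snd q) *\<^sub>R n) (B q)
      - action_density (\<mu> (fst (fst q))) (velocity c (fst (fst q)) (fst (snd (fst q))))
          (tangent c (fst (fst q)) (fst (snd (fst q)))) + \<nu> * (snd q)\<^sup>2)"
    have S: "open S" unfolding S_def by (intro open_Times) auto
    have contB: "continuous_on S B"
      unfolding B_def S_def by (intro continuous_intros c) auto
    define T where "T = S \<inter> B -` (- {0})"
    have T: "open T"
      unfolding T_def by (intro continuous_open_preimage contB S) auto
    have cont_\<mu>: "continuous_on T (\<lambda>q. \<mu> (fst (fst q)))"
      by (rule continuous_on_compose2[OF \<mu>(1)]) (auto simp: T_def S_def intro!: continuous_intros)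
    have "\<mu> (fst (fst q)) \<noteq> 0" "tangent c (fst (fst q)) (fst (snd (fst q))) \<noteq> 0" "B q \<noteq> 0"
      if "q \<in> T" for q
      using \<mu>(2)[of "fst (fst q)"] tangent_nonzero[OF c, of "fst (fst q)"] that
      by (force simp: T_def S_def)+
    then have "continuous_on T G"
      unfolding G_def action_density_def
      by (intro continuous_intros cont_\<mu> c continuous_on_subset[OF contB])
         (auto simp: T_def S_def)
    then have W: "open (T \<inter> G -` {..<\<kappa>})"
      by (intro continuous_open_preimage T) auto
    have "{(t0, \<theta>0, 0)} \<times> {-\<eta>..\<eta>} \<subseteq> T \<inter> G -` {..<\<kappa>}"
    proof
      fix q assume "q \<in> {(t0, \<theta>0, 0 :: real)} \<times> {-\<eta>..\<eta>}"
      then obtain x where q: "q = ((t0, \<theta>0, 0), x)" "\<bar>x\<bar> \<le> \<eta>" by auto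
      show "q \<in> T \<inter> G -` {..<\<kappa>}"
        using *(3)[OF q(2)] t0 \<open>\<kappa> > 0\<close> unfolding q(1) T_def S_def B_def G_def by auto
    qed
    from Elementary_Topology.tube_lemma[OF compact_Icc W this] obtain X0 where X0: "(t0, \<theta>0, 0) \<in> X0" "open X0"
      "X0 \<times> {-\<eta>..\<eta>} \<subseteq> T \<inter> G -` {..<\<kappa>}" by blast
    obtain e where e: "e > 0" "ball (t0, \<theta>0, 0) e \<subseteq> X0"
      using X0 open_contains_ball by blast
    have in_X0: "(t, \<theta>, z) \<in> X0" if "\<bar>t - t0\<bar> < e / 3" "\<bar>\<theta> - \<theta>0\<bar> < e / 3" "\<bar>z\<bar> < e / 3" for t \<theta> z
    proof -
      have "dist (t0, \<theta>0, 0) (t, \<theta>, z) \<le> dist t0 t + dist (\<theta>0, 0) (\<theta>, z)"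
        unfolding dist_Pair_Pair[of _ "(\<theta>0, 0)"]
        by (rule sqrt_sum_squares_le_sum) auto
      also have "\<dots> \<le> dist t0 t + (dist \<theta>0 \<theta> + dist 0 z)"
        unfolding dist_Pair_Pair[of \<theta>0]
        by (intro add_left_mono sqrt_sum_squares_le_sum) auto
      also have "\<dots> < e" using that unfolding dist_real_def by arith
      finally show ?thesis using e by auto
    qed
    show ?thesis
    proof (intro exI[of _ "e / 3"] conjI allI impI)
      fix t \<theta> x z
      assume "\<bar>t - t0\<bar> < e / 3" "\<bar>\<theta> - \<theta>0\<bar> < e / 3" "\<bar>z\<bar> < e / 3" and x: "\<bar>x\<bar> \<le> \<eta>"
      then have "((t, \<theta>, z), x) \<in> X0 \<times> {-\<eta>..\<eta>}"
        using in_X0 by auto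
      then have "((t, \<theta>, z), x) \<in> T \<inter> G -` {..<\<kappa>}"
        using X0(3) by blast
      then show "tangent c t \<theta> + x *\<^sub>R n \<noteq> 0"
        and "action_density (\<mu> t) (velocity c t \<theta> + (z - \<beta> * x) *\<^sub>R n) (tangent c t \<theta> + x *\<^sub>R n)
         - action_density (\<mu> t) (velocity c t \<theta>) (tangent c t \<theta>) \<le> \<kappa> - \<nu> * x\<^sup>2"
        by (auto simp: T_def S_def B_def G_def)
    qed (use e in auto)
  qed
  with *(1,2) show ?thesis by blast
qed

lemma perturbed_path:
  assumes c: "imm_path c"
    and u: "smooth_on ({0..1} \<times> UNIV) (\<lambda>(t, \<theta>). u t \<theta>)" "\<And>t. smooth_on UNIV (u t)"
      "\<And>t \<theta>. u t (\<theta> + 2 * pi) = u t \<theta>"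
      "\<And>t \<theta>. ((\<lambda>s. u s \<theta>) has_real_derivative u_t t \<theta>) (at t)"
      "\<And>t \<theta>. (u t has_real_derivative u_\<theta> t \<theta>) (at \<theta>)"
    and nz: "\<And>t \<theta>. t \<in> {0..1} \<Longrightarrow> tangent c t \<theta> + u_\<theta> t \<theta> *\<^sub>R n \<noteq> 0"
  defines "d \<equiv> \<lambda>t \<theta>. c t \<theta> + u t \<theta> *\<^sub>R n"
  shows "imm_path d"
    and "\<And>t \<theta>. t \<in> {0..1} \<Longrightarrow> tangent d t \<theta> = tangent c t \<theta> + u_\<theta> t \<theta> *\<^sub>R n"
    and "\<And>t \<theta>. t \<in> {0..1} \<Longrightarrow> velocity d t \<theta> = velocity c t \<theta> + u_t t \<theta> *\<^sub>R n"
proof -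
  have scale: "(f has_vector_derivative f') F \<Longrightarrow>
      ((\<lambda>x. f x *\<^sub>R n) has_vector_derivative f' *\<^sub>R n) F" for f f' F
    by (rule bounded_linear.has_vector_derivative[OF bounded_linear_scaleR_left])
  show tan: "tangent d t \<theta> = tangent c t \<theta> + u_\<theta> t \<theta> *\<^sub>R n" if "t \<in> {0..1}" for t \<theta>
    unfolding tangent_def[of d] unfolding d_def
    by (intro vector_derivative_at has_vector_derivative_add imm_path_has_tangent[OF c that] scale
        u(5)[unfolded has_real_derivative_iff_has_vector_derivative])
  show "velocity d t \<theta> = velocity c t \<theta> + u_t t \<theta> *\<^sub>R n" if "t \<in> {0..1}" for t \<theta>
  proof -
    have "((\<lambda>s. u s \<theta>) has_vector_derivative u_t t \<theta>) (at t within {0..1})"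
      by (rule has_vector_derivative_at_within,
          rule u(4)[unfolded has_real_derivative_iff_has_vector_derivative])
    from has_vector_derivative_add[OF imm_path_has_velocity[OF c that] scale[OF this]]
    show ?thesis
      unfolding velocity_def[of d] unfolding d_def
      by (rule vector_derivative_within_closed_interval[OF zero_less_one that])
  qed
  have "smooth_on ({0..1} \<times> UNIV) (\<lambda>x. (\<lambda>(t, \<theta>). c t \<theta>) x + (\<lambda>(t, \<theta>). u t \<theta>) x *\<^sub>R n)"
    using c u(1) unfolding imm_path_def
    by (intro smooth_on_add smooth_on_bounded_linear[OF bounded_linear_scaleR_left]) auto
  moreover have "d t \<in> Imm" if t: "t \<in> {0..1}" for t
  proof -
    have "smooth_on UNIV (d t)"
      using c u(2) t unfolding imm_path_def Imm_def d_def
      by (intro smooth_on_add smooth_on_bounded_linear[OF bounded_linear_scaleR_left]) auto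
    then show ?thesis
      using tan[OF t] nz[OF t] imm_path_periodic[OF c t] u(3)
      by (auto simp: Imm_def tangent_def d_def)
  qed
  ultimately show "imm_path d"
    unfolding imm_path_def by (simp add: d_def case_prod_unfold)
qed

lemma square_of_increment_le:
  fixes F g :: "real \<Rightarrow> real"
  assumes "a < b" "\<And>x. (F has_real_derivative g x) (at x)" "continuous_on UNIV g"
  shows "(F b - F a)\<^sup>2 / (b - a) \<le> integral {a..b} (\<lambda>x. (g x)\<^sup>2)"
proof -
  define k where "k = (F b - F a) / (b - a)"
  have g: "(g has_integral (F b - F a)) {a..b}"
    using assms(1,2) by (intro fundamental_theorem_of_calculus)
      (auto simp: has_real_derivative_iff_has_vector_derivative intro: has_vector_derivative_at_within)
  have g2: "((\<lambda>x. (g x)\<^sup>2) has_integral integral {a..b} (\<lambda>x. (g x)\<^sup>2)) {a..b}"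
    by (intro integrable_integral integrable_continuous_real continuous_intros
        continuous_on_subset[OF assms(3)]) auto
  have "((\<lambda>x. 2 * k * g x - k\<^sup>2) has_integral (2 * k * (F b - F a) - (b - a) * k\<^sup>2)) {a..b}"
    using has_integral_diff[OF has_integral_mult_right[OF g, of "2 * k"] has_integral_const_real[of "k\<^sup>2" a b]]
      assms(1) by simp
  then have "2 * k * (F b - F a) - (b - a) * k\<^sup>2 \<le> integral {a..b} (\<lambda>x. (g x)\<^sup>2)"
  proof (rule has_integral_le[OF _ g2])
    fix x
    have "0 \<le> (g x - k)\<^sup>2" by simp
    then show "2 * k * g x - k\<^sup>2 \<le> (g x)\<^sup>2" by (simp add: power2_eq_square algebra_simps)
  qed
  moreover have "2 * k * (F b - F a) - (b - a) * k\<^sup>2 = (F b - F a)\<^sup>2 / (b - a)"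
    using assms(1) by (simp add: k_def power2_eq_square)
  ultimately show ?thesis by simp
qed

text \<open>
  Since \<open>f\<close> climbs from \<open>0\<close> to \<open>1\<close>, so does \<open>f\<^sup>3\<close>, whose derivative is at most
  \<open>3 M f\<^sup>2\<close>.
\<close>
lemma integral_square_lower_bound_of_Lipschitz:
  fixes f f' :: "real \<Rightarrow> real"
  assumes "a < b" "\<And>x. (f has_real_derivative f' x) (at x)" "\<And>x. f' x \<le> M" "M > 0"
    and "f a = 0" "f b = 1"
  shows "1 / (3 * M) \<le> integral {a..b} (\<lambda>x. (f x)\<^sup>2)"
proof -
  have cont: "continuous_on {a..b} f"
    using assms(2) by (meson DERIV_continuous continuous_at_imp_continuous_on)
  have "((\<lambda>x. 3 * (f x)\<^sup>2 * f' x) has_integral ((f b)^3 - (f a)^3)) {a..b}"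
  proof (rule fundamental_theorem_of_calculus)
    show "((\<lambda>x. (f x)^3) has_vector_derivative 3 * (f x)\<^sup>2 * f' x) (at x within {a..b})" for x
      using DERIV_power[OF assms(2), of 3 x]
      by (auto simp: has_real_derivative_iff_has_vector_derivative mult_ac
          intro: has_vector_derivative_at_within)
  qed (use assms in auto)
  then have "((\<lambda>x. 3 * (f x)\<^sup>2 * f' x) has_integral 1) {a..b}"
    using assms by simp
  moreover have "((\<lambda>x. 3 * M * (f x)\<^sup>2) has_integral 3 * M * integral {a..b} (\<lambda>x. (f x)\<^sup>2)) {a..b}"
    by (intro has_integral_mult_right integrable_integral integrable_continuous_real
        continuous_intros cont)
  ultimately have "1 \<le> 3 * M * integral {a..b} (\<lambda>x. (f x)\<^sup>2)"
  proof (rule has_integral_le)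
    fix x
    show "3 * (f x)\<^sup>2 * f' x \<le> 3 * M * (f x)\<^sup>2"
      using mult_left_mono[OF assms(3)[of x], of "3 * (f x)\<^sup>2"] by (simp add: mult_ac)
  qed
  then show ?thesis using assms by (simp add: field_simps)
qed

lemma integral_restrict_to_support:
  fixes f :: "real \<Rightarrow> real"
  assumes "{a..b} \<subseteq> {A..B}" "\<And>x. x \<in> {A..B} - {a..b} \<Longrightarrow> f x = 0"
  shows "integral {A..B} f = integral {a..b} f"
proof -
  have "(f has_integral i) {A..B} \<longleftrightarrow> (f has_integral i) {a..b}" for i
  proof -
    have "(f has_integral i) {A..B} \<longleftrightarrow>
        ((\<lambda>x. if x \<in> {a..b} then f x else 0) has_integral i) {A..B}"
      using assms(2) by (intro has_integral_cong) auto
    then show ?thesis by (simp only: has_integral_restrict[OF assms(1)])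
  qed
  then show ?thesis by (simp add: integral_def integrable_on_def)
qed

text \<open>
  Suppose the normal speed at \<open>(t0, \<theta>0)\<close> times the length exceeds \<open>v\<close>. Add to the curves a tooth
  \<open>u t \<theta> *\<^sub>R n\<close> in the fixed direction \<open>n\<close>, of width \<open>r\<close> in \<open>\<theta>\<close> and \<open>s\<close> in \<open>t\<close>, that drifts along
  \<open>\<theta> = \<alpha> t\<close> with parameter speed \<open>\<beta>\<close>. Its height is of order \<open>r\<close>, so its slope \<open>x = u_\<theta>\<close> stays of
  order one however small it is. Its time derivative is \<open>- \<beta> x\<close> because of the drift, plus a term
  \<open>z\<close> of order \<open>r/s\<close>, which is small for \<open>r = s\<^sup>2\<close>. Hence the action density changes by
  at most \<open>\<kappa> - \<nu> x\<^sup>2\<close> on the support of the tooth. The area of the support and the integral of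
  \<open>x\<^sup>2\<close> over it are both of order \<open>r s\<close>, with constants that depend neither on \<open>\<kappa>\<close> nor on
  \<open>s\<close>, so for small \<open>\<kappa>\<close> the gain prevails.
\<close>
lemma exists_shorter_path:
  assumes c: "imm_path c" and v: "v > 0" "\<And>t. t \<in> {0..1} \<Longrightarrow> speed (\<lambda>l. l) c t = v"
    and t0: "0 < t0" "t0 < 1" and \<theta>0: "0 < \<theta>0" "\<theta>0 < 2 * pi"
    and fast: "v * norm (tangent c t0 \<theta>0) < \<bar>sweep c t0 \<theta>0\<bar> * curve_length (c t0)"
  obtains d where "imm_path d" "d 0 = c 0" "d 1 = c 1"
    "path_length_G (\<lambda>l. l) d < path_length_G (\<lambda>l. l) c"
proof -
  \<comment> \<open>The value for which the arithmetic-geometric mean bound is an equality along \<open>c\<close>.\<close>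
  define \<mu> where "\<mu> t = v / curve_length (c t)" for t
  have len: "curve_length (c t) > 0" if "t \<in> {0..1}" for t
    using curve_length_pos[OF c that] .
  have \<mu>: "continuous_on {0..1} \<mu>" "\<And>t. t \<in> {0..1} \<Longrightarrow> \<mu> t > 0"
    unfolding \<mu>_def using len v
    by (force intro!: continuous_intros continuous_on_curve_length[OF c])+
  have cost_c: "\<mu> t * curve_length (c t) + sweep_energy c t / \<mu> t = 2 * v" if t: "t \<in> {0..1}" for t
  proof -
    have "(sqrt (curve_length (c t) * sweep_energy c t))\<^sup>2 = v\<^sup>2"
      using v(2)[OF t] speed_eq[OF c t] by simp
    then have "curve_length (c t) * sweep_energy c t = v\<^sup>2"
      using len[OF t] sweep_energy_nonneg[OF c t] by simp
    then have "sweep_energy c t / \<mu> t = v"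
      using v len[OF t] by (simp add: \<mu>_def power2_eq_square field_simps)
    then show ?thesis using len[OF t] by (simp add: \<mu>_def)
  qed
  have "\<mu> t0 * norm (tangent c t0 \<theta>0) < \<bar>sweep c t0 \<theta>0\<bar>"
    using fast len[of t0] t0 by (simp add: \<mu>_def field_simps)
  then have "(\<mu> t0 * norm (tangent c t0 \<theta>0))\<^sup>2 < \<bar>sweep c t0 \<theta>0\<bar>\<^sup>2"
    using \<mu>(2)[of t0] t0 by (intro power_strict_mono) auto
  then have fast': "(\<mu> t0 * norm (tangent c t0 \<theta>0))\<^sup>2 < (sweep c t0 \<theta>0)\<^sup>2" by simp
  obtain n \<beta> \<eta> \<nu> where \<eta>: "\<eta> > 0" and \<nu>: "\<nu> > 0" and gain:
    "\<And>\<kappa>. \<kappa> > 0 \<Longrightarrow> \<exists>\<delta>>0. \<forall>t \<theta> x z. \<bar>t - t0\<bar> < \<delta> \<longrightarrow> \<bar>\<theta> - \<theta>0\<bar> < \<delta> \<longrightarrow> \<bar>z\<bar> < \<delta> \<longrightarrow> \<bar>x\<bar> \<le> \<eta> \<longrightarrow>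
       tangent c t \<theta> + x *\<^sub>R n \<noteq> 0 \<and>
       action_density (\<mu> t) (velocity c t \<theta> + (z - \<beta> * x) *\<^sub>R n) (tangent c t \<theta> + x *\<^sub>R n)
         - action_density (\<mu> t) (velocity c t \<theta>) (tangent c t \<theta>) \<le> \<kappa> - \<nu> * x\<^sup>2"
    using density_decreases_near_point[OF c t0 \<mu> fast'] by blast
  obtain C where C: "C > 0"
    "\<And>r. 0 < r \<Longrightarrow> r \<le> 1 \<Longrightarrow> \<exists>b b'. smooth_on UNIV b \<and> (\<forall>x. b (x + 2 * pi) = b x) \<and>
       (\<forall>x. (b has_real_derivative b' x) (at x)) \<and> continuous_on UNIV b' \<and>
       (\<forall>x. \<bar>b' x\<bar> \<le> C / r) \<and> b 0 = 1 \<and> (\<forall>x. 0 \<le> b x \<and> b x \<le> 1) \<and>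
       (\<forall>x. r \<le> \<bar>x\<bar> \<longrightarrow> \<bar>x\<bar> \<le> 2 * pi - r \<longrightarrow> b x = 0 \<and> b' x = 0)"
    by (rule circle_bump_family) blast
  \<comment> \<open>The height \<open>\<epsilon> r\<close> makes the slope at most \<open>\<eta>\<close>. The constant in \<open>\<kappa>\<close> makes the loss
    \<open>4 r s \<kappa>\<close> half of the gain \<open>\<nu> \<epsilon>\<^sup>2 r s / (3 C)\<close> at the end.\<close>
  define \<epsilon> where "\<epsilon> = \<eta> / C"
  have \<epsilon>: "\<epsilon> > 0" using \<eta> C by (simp add: \<epsilon>_def)
  define \<kappa> where "\<kappa> = \<nu> * \<epsilon>\<^sup>2 / (24 * C)"
  have "\<kappa> > 0" using \<nu> \<epsilon> C by (simp add: \<kappa>_def)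
  from gain[OF this] obtain \<delta>' where "\<delta>' > 0" and \<delta>': "\<And>t \<theta> x z.
      \<bar>t - t0\<bar> < \<delta>' \<Longrightarrow> \<bar>\<theta> - \<theta>0\<bar> < \<delta>' \<Longrightarrow> \<bar>z\<bar> < \<delta>' \<Longrightarrow> \<bar>x\<bar> \<le> \<eta> \<Longrightarrow>
       tangent c t \<theta> + x *\<^sub>R n \<noteq> 0 \<and>
       action_density (\<mu> t) (velocity c t \<theta> + (z - \<beta> * x) *\<^sub>R n) (tangent c t \<theta> + x *\<^sub>R n)
         - action_density (\<mu> t) (velocity c t \<theta>) (tangent c t \<theta>) \<le> \<kappa> - \<nu> * x\<^sup>2"
    by blast
  \<comment> \<open>Small enough for the tooth to stay inside the open rectangle \<open>(0, 1) \<times> (0, 2\<pi>)\<close> as well.\<close>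
  let ?M = "{\<delta>', t0, 1 - t0, \<theta>0, 2 * pi - \<theta>0, 1}"
  define \<delta> where "\<delta> = Min ?M"
  have "\<delta> > 0"
    using \<open>\<delta>' > 0\<close> t0 \<theta>0 unfolding \<delta>_def by (subst Min_gr_iff) auto
  moreover have "\<delta> \<le> y" if "y \<in> ?M" for y
    unfolding \<delta>_def by (rule Min_le[OF _ that]) simp
  ultimately have \<delta>: "\<delta> > 0" "\<delta> \<le> \<delta>'" "\<delta> \<le> t0" "\<delta> \<le> 1 - t0" "\<delta> \<le> \<theta>0"
    "\<delta> \<le> 2 * pi - \<theta>0" "\<delta> \<le> 1"
    by blast+
  define s where "s = \<delta> / (2 * (1 + \<bar>\<beta>\<bar> + \<eta>))"
  define r where "r = s\<^sup>2"
  have "0 < s" and s_le: "(1 + \<bar>\<beta>\<bar> + \<eta>) * s < \<delta>"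
    using \<delta>(1) \<eta> by (simp_all add: s_def field_simps add_pos_nonneg)
  have "s + \<bar>\<beta>\<bar> * s + \<eta> * s < \<delta>" using s_le by (simp add: algebra_simps)
  moreover have "0 \<le> \<bar>\<beta>\<bar> * s" "0 < \<eta> * s" using \<open>0 < s\<close> \<eta> by auto
  ultimately have s: "s < \<delta>" "\<eta> * s < \<delta>" "s + \<bar>\<beta>\<bar> * s < \<delta>"
    using \<open>0 < s\<close> by linarith+
  have "s \<le> 1" using s \<delta> by simp
  have r: "0 < r" "r \<le> s"
    using \<open>0 < s\<close> \<open>s \<le> 1\<close> mult_left_le[of s s] by (simp_all add: r_def power2_eq_square)
  obtain b b' where b: "smooth_on UNIV b" "\<And>x. b (x + 2 * pi) = b x"
      "\<And>x. (b has_real_derivative b' x) (at x)" "continuous_on UNIV b'"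
      "\<And>x. \<bar>b' x\<bar> \<le> C / r" "b 0 = 1" "\<And>x. 0 \<le> b x \<and> b x \<le> 1"
      "\<And>x. r \<le> \<bar>x\<bar> \<Longrightarrow> \<bar>x\<bar> \<le> 2 * pi - r \<Longrightarrow> b x = 0 \<and> b' x = 0"
    using C(2)[of r] r \<open>s \<le> 1\<close> by auto
  obtain f f' where f: "smooth_on UNIV f" "\<And>x. f (x + 2 * pi) = f x"
      "\<And>x. (f has_real_derivative f' x) (at x)" "continuous_on UNIV f'"
      "\<And>x. \<bar>f' x\<bar> \<le> C / s" "f 0 = 1" "\<And>x. 0 \<le> f x \<and> f x \<le> 1"
      "\<And>x. s \<le> \<bar>x\<bar> \<Longrightarrow> \<bar>x\<bar> \<le> 2 * pi - s \<Longrightarrow> f x = 0 \<and> f' x = 0"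
    using C(2)[of s] \<open>0 < s\<close> \<open>s \<le> 1\<close> by auto
  define \<alpha> where "\<alpha> t = \<theta>0 + \<beta> * (t - t0)" for t
  define u where "u t \<theta> = \<epsilon> * r * (f (t - t0) * b (\<theta> - \<alpha> t))" for t \<theta>
  define u_\<theta> where "u_\<theta> t \<theta> = \<epsilon> * r * (f (t - t0) * b' (\<theta> - \<alpha> t))" for t \<theta>
  define z where "z t \<theta> = \<epsilon> * r * (f' (t - t0) * b (\<theta> - \<alpha> t))" for t \<theta>
  define d where "d = (\<lambda>t \<theta>. c t \<theta> + u t \<theta> *\<^sub>R n)"
  have f_zero: "f (t - t0) = 0" "f' (t - t0) = 0" if "t \<in> {0..1}" "s \<le> \<bar>t - t0\<bar>" for t
    using f(8)[of "t - t0"] that t0 pi_gt3 \<open>s \<le> 1\<close> by auto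
  have \<alpha>: "\<bar>\<alpha> t - \<theta>0\<bar> \<le> \<bar>\<beta>\<bar> * s" if "\<bar>t - t0\<bar> \<le> s" for t
    using that by (simp add: \<alpha>_def abs_mult mult_left_mono)
  have \<alpha>_range: "r \<le> \<alpha> t" "\<alpha> t \<le> 2 * pi - r" if "\<bar>t - t0\<bar> \<le> s" for t
    using \<alpha>[OF that] s(3) r(2) \<delta> by linarith+
  have b_zero: "b (\<theta> - \<alpha> t) = 0" "b' (\<theta> - \<alpha> t) = 0"
    if "\<theta> \<in> {0..2 * pi}" "\<bar>t - t0\<bar> \<le> s" "r \<le> \<bar>\<theta> - \<alpha> t\<bar>" for t \<theta>
    using b(8)[of "\<theta> - \<alpha> t"] that \<alpha>_range[OF that(2)] by auto
  have x_bound: "\<bar>u_\<theta> t \<theta>\<bar> \<le> \<eta>" for t \<theta>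
  proof -
    have "\<bar>f (t - t0)\<bar> * \<bar>b' (\<theta> - \<alpha> t)\<bar> \<le> 1 * (C / r)"
      using f(7) b(5) by (intro mult_mono) auto
    then have "\<epsilon> * r * (\<bar>f (t - t0)\<bar> * \<bar>b' (\<theta> - \<alpha> t)\<bar>) \<le> \<epsilon> * r * (1 * (C / r))"
      using \<epsilon> r by (intro mult_left_mono) auto
    also have "\<dots> = \<eta>" using r C by (simp add: \<epsilon>_def)
    finally show ?thesis using \<epsilon> r by (simp add: u_\<theta>_def abs_mult)
  qed
  have z_bound: "\<bar>z t \<theta>\<bar> < \<delta>" for t \<theta>
  proof -
    have "\<bar>f' (t - t0)\<bar> * \<bar>b (\<theta> - \<alpha> t)\<bar> \<le> (C / s) * 1"
      using f(5) b(7) C \<open>0 < s\<close> by (intro mult_mono) auto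
    then have "\<epsilon> * r * (\<bar>f' (t - t0)\<bar> * \<bar>b (\<theta> - \<alpha> t)\<bar>) \<le> \<epsilon> * r * ((C / s) * 1)"
      using \<epsilon> r by (intro mult_left_mono) auto
    also have "\<dots> = \<eta> * s" using \<open>0 < s\<close> C by (simp add: \<epsilon>_def r_def power2_eq_square)
    finally show ?thesis using \<epsilon> r s(2) by (simp add: z_def abs_mult)
  qed
  have near: "tangent c t \<theta> + u_\<theta> t \<theta> *\<^sub>R n \<noteq> 0 \<and>
       action_density (\<mu> t) (velocity c t \<theta> + (z t \<theta> - \<beta> * u_\<theta> t \<theta>) *\<^sub>R n) (tangent c t \<theta> + u_\<theta> t \<theta> *\<^sub>R n)
         - action_density (\<mu> t) (velocity c t \<theta>) (tangent c t \<theta>) \<le> \<kappa> - \<nu> * (u_\<theta> t \<theta>)\<^sup>2"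
    if "\<bar>t - t0\<bar> \<le> s" "\<bar>\<theta> - \<alpha> t\<bar> \<le> r" for t \<theta>
    using that \<alpha>[OF that(1)] s r \<delta>(2) z_bound[of t \<theta>] x_bound[of t \<theta>] by (intro \<delta>') linarith+
  have far: "u_\<theta> t \<theta> = 0 \<and> z t \<theta> = 0"
    if "t \<in> {0..1}" "\<theta> \<in> {0..2 * pi}" "\<not> (\<bar>t - t0\<bar> \<le> s \<and> \<bar>\<theta> - \<alpha> t\<bar> \<le> r)" for t \<theta>
    using that f_zero[of t] b_zero[of \<theta> t] by (cases "\<bar>t - t0\<bar> \<le> s") (auto simp: u_\<theta>_def z_def)
  have nz: "tangent c t \<theta> + u_\<theta> t \<theta> *\<^sub>R n \<noteq> 0" if t: "t \<in> {0..1}" for t \<theta>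
  proof -
    have b'_per: "b' (x + 2 * pi) = b' x" for x
    proof -
      have "((\<lambda>x. b (x + 2 * pi)) has_real_derivative b' (x + 2 * pi)) (at x)"
        using b(3)[of "x + 2 * pi"] by (simp only: DERIV_shift)
      then show ?thesis
        using b(3) DERIV_unique by (simp add: b(2)) blast
    qed
    have "u_\<theta> t (\<theta> + 2 * pi) = u_\<theta> t \<theta>" for \<theta>
      using b'_per[of "\<theta> - \<alpha> t"] by (simp add: u_\<theta>_def algebra_simps)
    then have "tangent c t (\<theta> + 2 * pi) + u_\<theta> t (\<theta> + 2 * pi) *\<^sub>R n
        = tangent c t \<theta> + u_\<theta> t \<theta> *\<^sub>R n" for \<theta>
      using tangent_periodic[OF c t] by simp
    then obtain y where y: "y \<in> {0..2 * pi}"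
      "tangent c t y + u_\<theta> t y *\<^sub>R n = tangent c t \<theta> + u_\<theta> t \<theta> *\<^sub>R n"
      by (rule periodic_representative[of "\<lambda>\<theta>. tangent c t \<theta> + u_\<theta> t \<theta> *\<^sub>R n"])
    have "tangent c t y + u_\<theta> t y *\<^sub>R n \<noteq> 0"
      using near[of t y] far[OF t y(1)] tangent_nonzero[OF c t, of y] by fastforce
    then show ?thesis using y by simp
  qed
  have u_smooth: "smooth_on ({0..1} \<times> UNIV) (\<lambda>(t, \<theta>). u t \<theta>)"
  proof -
    have "smooth_on S (\<lambda>q :: real \<times> real. \<epsilon> * r * (f (fst q + - t0) *
        b (snd q + (- \<theta>0 + \<beta> * t0) + - \<beta> * fst q)))" for S
      by (intro smooth_on_mult smooth_on_const smooth_on_compose[OF f(1)] smooth_on_compose[OF b(1)]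
          smooth_on_add smooth_on_bounded_linear[OF bounded_linear_fst]
          smooth_on_bounded_linear[OF bounded_linear_snd] smooth_on_id)
    moreover have "(\<lambda>(t, \<theta>). u t \<theta>) = (\<lambda>q. \<epsilon> * r * (f (fst q + - t0) *
        b (snd q + (- \<theta>0 + \<beta> * t0) + - \<beta> * fst q)))"
      by (auto simp: fun_eq_iff u_def \<alpha>_def algebra_simps)
    ultimately show ?thesis by (simp only:)
  qed
  have u_smooth1: "smooth_on UNIV (u t)" for t
  proof -
    have "smooth_on UNIV (\<lambda>\<theta>. \<epsilon> * r * (f (t - t0) * b (\<theta> + - \<alpha> t)))"
      by (intro smooth_on_mult smooth_on_const smooth_on_compose[OF b(1)] smooth_on_add smooth_on_id)
    then show ?thesis by (simp add: u_def[abs_def])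
  qed
  have u_per: "u t (\<theta> + 2 * pi) = u t \<theta>" for t \<theta>
    using b(2)[of "\<theta> - \<alpha> t"] by (simp add: u_def algebra_simps)
  have f_shift: "((\<lambda>t. f (t - t0)) has_real_derivative f' (t - t0)) (at t)" for t
    using f(3)[of "t - t0"] DERIV_shift[of f "f' (t - t0)" t "- t0"] by simp
  have u_dt: "((\<lambda>t. u t \<theta>) has_real_derivative (z t \<theta> - \<beta> * u_\<theta> t \<theta>)) (at t)" for t \<theta>
  proof -
    have "((\<lambda>t. \<theta> - \<alpha> t) has_real_derivative (- \<beta>)) (at t)"
      unfolding \<alpha>_def by (auto intro!: derivative_eq_intros)
    from DERIV_chain2[OF b(3) this]
    have 2: "((\<lambda>t. b (\<theta> - \<alpha> t)) has_real_derivative b' (\<theta> - \<alpha> t) * - \<beta>) (at t)" .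
    show ?thesis
      unfolding u_def u_\<theta>_def z_def using DERIV_cmult[OF DERIV_mult[OF f_shift 2], of "\<epsilon> * r"]
      by (simp add: algebra_simps)
  qed
  have u_d\<theta>: "(u t has_real_derivative u_\<theta> t \<theta>) (at \<theta>)" for t \<theta>
  proof -
    have "((\<lambda>\<theta>. b (\<theta> - \<alpha> t)) has_real_derivative b' (\<theta> - \<alpha> t)) (at \<theta>)"
      using b(3)[of "\<theta> - \<alpha> t"] DERIV_shift[of b "b' (\<theta> - \<alpha> t)" \<theta> "- \<alpha> t"] by simp
    from DERIV_cmult[OF DERIV_cmult[OF this]] show ?thesis
      unfolding u_def[abs_def] u_\<theta>_def .
  qed
  note pert' = perturbed_path[OF c u_smooth u_smooth1 u_per u_dt u_d\<theta>, of n, folded d_def]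
  have pert: "imm_path d"
    "\<And>t \<theta>. t \<in> {0..1} \<Longrightarrow> tangent d t \<theta> = tangent c t \<theta> + u_\<theta> t \<theta> *\<^sub>R n"
    "\<And>t \<theta>. t \<in> {0..1} \<Longrightarrow> velocity d t \<theta> = velocity c t \<theta> + (z t \<theta> - \<beta> * u_\<theta> t \<theta>) *\<^sub>R n"
    by (rule pert'; (rule nz, assumption | assumption))+
  have ends: "d 0 = c 0" "d 1 = c 1"
    using f_zero[of 0] f_zero[of 1] t0 s \<delta> by (auto simp: d_def u_def fun_eq_iff)
  \<comment> \<open>\<open>W t\<close> is the change of the total action at time \<open>t\<close>.\<close>
  define D where "D t \<theta> = action_density (\<mu> t) (velocity d t \<theta>) (tangent d t \<theta>)
      - action_density (\<mu> t) (velocity c t \<theta>) (tangent c t \<theta>)" for t \<theta>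
  define W where "W t = \<mu> t * curve_length (d t) + sweep_energy d t / \<mu> t - 2 * v" for t
  have D_int: "(D t has_integral W t) {0..2 * pi}" if "t \<in> {0..1}" for t
    using has_integral_diff[OF integral_density[OF pert(1) that] integral_density[OF c that], of "\<mu> t" "\<mu> t"]
    unfolding D_def[abs_def] W_def cost_c[OF that] .
  have D_far: "D t \<theta> = 0"
    if "t \<in> {0..1}" "\<theta> \<in> {0..2 * pi}" "\<not> (\<bar>t - t0\<bar> \<le> s \<and> \<bar>\<theta> - \<alpha> t\<bar> \<le> r)" for t \<theta>
    using far[OF that] pert(2,3)[OF that(1)] by (simp add: D_def)
  have D_near: "D t \<theta> \<le> \<kappa> - \<nu> * (u_\<theta> t \<theta>)\<^sup>2"
    if "t \<in> {0..1}" "\<bar>t - t0\<bar> \<le> s" "\<bar>\<theta> - \<alpha> t\<bar> \<le> r" for t \<theta>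
    using near[OF that(2,3)] pert(2,3)[OF that(1)] by (simp add: D_def)
  have cont_u\<theta>: "continuous_on A (u_\<theta> t)" for A t
    unfolding u_\<theta>_def by (intro continuous_intros continuous_on_compose2[OF b(4)]) auto
  have W_near: "W t \<le> 2 * r * \<kappa> - \<nu> * \<epsilon>\<^sup>2 * r * (f (t - t0))\<^sup>2"
    if t: "t \<in> {0..1}" "\<bar>t - t0\<bar> \<le> s" for t
  proof -
    have sub: "{\<alpha> t - r..\<alpha> t + r} \<subseteq> {0..2 * pi}" using \<alpha>_range[OF t(2)] by auto
    have "W t = integral {0..2 * pi} (D t)" using D_int[OF t(1)] by (simp add: integral_unique)
    also have "\<dots> = integral {\<alpha> t - r..\<alpha> t + r} (D t)"
      by (rule integral_restrict_to_support[OF sub]) (auto intro!: D_far[OF t(1)])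
    also have "\<dots> \<le> integral {\<alpha> t - r..\<alpha> t + r} (\<lambda>\<theta>. \<kappa> - \<nu> * (u_\<theta> t \<theta>)\<^sup>2)"
    proof (rule integral_le)
      show "D t integrable_on {\<alpha> t - r..\<alpha> t + r}"
        using D_int[OF t(1)] sub integrable_on_subinterval by blast
      show "(\<lambda>\<theta>. \<kappa> - \<nu> * (u_\<theta> t \<theta>)\<^sup>2) integrable_on {\<alpha> t - r..\<alpha> t + r}"
        by (intro integrable_continuous_real continuous_intros cont_u\<theta>)
    qed (use D_near[OF t] in auto)
    also have "\<dots> = 2 * r * \<kappa> - \<nu> * integral {\<alpha> t - r..\<alpha> t + r} (\<lambda>\<theta>. (u_\<theta> t \<theta>)\<^sup>2)"
      using r by (subst integral_diff)
        (auto intro!: integrable_continuous_real continuous_intros cont_u\<theta>)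
    also have "\<dots> \<le> 2 * r * \<kappa> - \<nu> * (\<epsilon>\<^sup>2 * r * (f (t - t0))\<^sup>2)"
    proof -
      have "u t (\<alpha> t) = \<epsilon> * r * f (t - t0)" "u t (\<alpha> t - r) = 0"
        using b(6) b_zero[of "\<alpha> t - r" t] \<alpha>_range[OF t(2)] t r by (auto simp: u_def)
      \<comment> \<open>Going up the left flank of the tooth costs this much by Cauchy-Schwarz.\<close>
      then have "\<epsilon>\<^sup>2 * r * (f (t - t0))\<^sup>2 = (u t (\<alpha> t) - u t (\<alpha> t - r))\<^sup>2 / (\<alpha> t - (\<alpha> t - r))"
        using r by (simp add: power2_eq_square)
      also have "\<dots> \<le> integral {\<alpha> t - r..\<alpha> t} (\<lambda>\<theta>. (u_\<theta> t \<theta>)\<^sup>2)"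
        using r by (intro square_of_increment_le u_d\<theta> cont_u\<theta>) auto
      also have "\<dots> \<le> integral {\<alpha> t - r..\<alpha> t + r} (\<lambda>\<theta>. (u_\<theta> t \<theta>)\<^sup>2)"
        using r by (intro integral_subset_le)
          (auto intro!: integrable_continuous_real continuous_intros cont_u\<theta>)
      finally show ?thesis using \<nu> by (simp add: mult_left_mono)
    qed
    finally show ?thesis by (simp add: mult.assoc)
  qed
  have W_far: "W t = 0" if "t \<in> {0..1}" "\<not> \<bar>t - t0\<bar> \<le> s" for t
  proof -
    have "(D t has_integral 0) {0..2 * pi}"
      using D_far that by (intro has_integral_is_0) auto
    then show ?thesis using D_int[OF that(1)] has_integral_unique by blast
  qed
  have W_cont: "continuous_on {0..1} W"
    unfolding W_def using \<mu>
    by (intro continuous_intros continuous_on_curve_length continuous_on_sweep_energy pert(1)) force+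
  have cont_f: "continuous_on A f" for A
    using smooth_on_imp_continuous_on[OF f(1)] continuous_on_subset by blast
  have W_neg: "integral {0..1} W < 0"
  proof -
    have sub: "{t0 - s..t0 + s} \<subseteq> {0..1}" using s \<delta> by auto
    have "integral {0..1} W = integral {t0 - s..t0 + s} W"
      by (rule integral_restrict_to_support[OF sub]) (auto intro!: W_far)
    also have "\<dots> \<le> integral {t0 - s..t0 + s} (\<lambda>t. 2 * r * \<kappa> - \<nu> * \<epsilon>\<^sup>2 * r * (f (t - t0))\<^sup>2)"
    proof (rule integral_le)
      show "W integrable_on {t0 - s..t0 + s}"
        using W_cont sub by (intro integrable_continuous_real) (rule continuous_on_subset)
      show "(\<lambda>t. 2 * r * \<kappa> - \<nu> * \<epsilon>\<^sup>2 * r * (f (t - t0))\<^sup>2) integrable_on {t0 - s..t0 + s}"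
        by (intro integrable_continuous_real continuous_intros continuous_on_compose2[OF cont_f]) auto
      show "W t \<le> 2 * r * \<kappa> - \<nu> * \<epsilon>\<^sup>2 * r * (f (t - t0))\<^sup>2" if "t \<in> {t0 - s..t0 + s}" for t
        using that sub by (intro W_near) auto
    qed
    also have "\<dots> = 4 * r * s * \<kappa> - \<nu> * \<epsilon>\<^sup>2 * r * integral {t0 - s..t0 + s} (\<lambda>t. (f (t - t0))\<^sup>2)"
      using \<open>0 < s\<close> by (subst integral_diff)
        (auto intro!: integrable_continuous_real continuous_intros continuous_on_compose2[OF cont_f])
    also have "\<dots> \<le> 4 * r * s * \<kappa> - \<nu> * \<epsilon>\<^sup>2 * r * (s / (3 * C))"
    proof -
      have "1 / (3 * (C / s)) \<le> integral {t0 - s..t0} (\<lambda>t. (f (t - t0))\<^sup>2)"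
      proof (rule integral_square_lower_bound_of_Lipschitz[OF _ f_shift])
        show "f' (t - t0) \<le> C / s" for t using f(5)[of "t - t0"] by linarith
        show "f (t0 - s - t0) = 0" using f_zero[of "t0 - s"] \<open>0 < s\<close> sub by auto
      qed (use f(6) \<open>0 < s\<close> C in auto)
      also have "\<dots> \<le> integral {t0 - s..t0 + s} (\<lambda>t. (f (t - t0))\<^sup>2)"
        using \<open>0 < s\<close> by (intro integral_subset_le)
          (auto intro!: integrable_continuous_real continuous_intros continuous_on_compose2[OF cont_f])
      finally have "s / (3 * C) \<le> integral {t0 - s..t0 + s} (\<lambda>t. (f (t - t0))\<^sup>2)" by simp
      then show ?thesis using \<nu> \<epsilon> r by (intro diff_left_mono mult_left_mono) auto
    qed
    also have "\<dots> = - (r * s * \<nu> * \<epsilon>\<^sup>2 / (6 * C))"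
      using C by (simp add: \<kappa>_def field_simps)
    also have "\<dots> < 0" using r \<open>0 < s\<close> \<nu> \<epsilon> C by simp
    finally show ?thesis .
  qed
  have "path_length_G (\<lambda>l. l) d \<le> integral {0..1} (\<lambda>t. v + W t / 2)"
    unfolding path_length_G_def
  proof (rule integral_le)
    show "speed (\<lambda>l. l) d integrable_on {0..1}"
      by (intro integrable_continuous_real continuous_on_speed pert(1))
    show "(\<lambda>t. v + W t / 2) integrable_on {0..1}"
      by (intro integrable_continuous_real continuous_intros W_cont) auto
    show "speed (\<lambda>l. l) d t \<le> v + W t / 2" if "t \<in> {0..1}" for t
      using speed_le_integral_density[OF pert(1) that \<mu>(2)[OF that]]
      by (simp add: W_def diff_divide_distrib)
  qed
  also have "\<dots> = v + integral {0..1} W / 2"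
    by (subst integral_add) (auto intro!: integrable_continuous_real continuous_intros W_cont)
  also have "\<dots> < v" using W_neg by simp
  also have "v = path_length_G (\<lambda>l. l) c"
    using path_length_constant_speed[of "\<lambda>l. l" c v] v(2) by simp
  finally show ?thesis using that pert(1) ends by blast
qed

section \<open>Minimal geodesics\<close>

text \<open>
  At interior points the opposite inequality would provide a shorter path; the boundary of the
  rectangle \<open>[0, 1] \<times> [0, 2\<pi>]\<close> is reached by continuity.
\<close>
lemma minimal_geodesic_normal_speed_le:
  assumes geo: "minimal_geodesic (\<lambda>l. l) c"
    and v: "\<And>t. t \<in> {0..1} \<Longrightarrow> speed (\<lambda>l. l) c t = v" "v > 0"
    and t: "t \<in> {0..1}" and \<theta>: "\<theta> \<in> {0..2 * pi}"
  shows "\<bar>sweep c t \<theta>\<bar> * curve_length (c t) \<le> v * norm (tangent c t \<theta>)"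
proof -
  have c: "imm_path c" using geo by (simp add: minimal_geodesic_def)
  define g where "g q = \<bar>sweep c (fst q) (snd q)\<bar> * curve_length (c (fst q))
     - v * norm (tangent c (fst q) (snd q))" for q
  have interior: "g q \<le> 0" if q: "q \<in> {0<..<1} \<times> {0<..<2 * pi}" for q
  proof (rule ccontr)
    assume "\<not> g q \<le> 0"
    then have fast: "v * norm (tangent c (fst q) (snd q))
        < \<bar>sweep c (fst q) (snd q)\<bar> * curve_length (c (fst q))"
      by (simp add: g_def)
    have q': "0 < fst q" "fst q < 1" "0 < snd q" "snd q < 2 * pi"
      using q by (auto simp: mem_Times_iff)
    from exists_shorter_path[OF c v(2,1) q' fast]
    obtain d where "imm_path d" "d 0 = c 0" "d 1 = c 1"
      "path_length_G (\<lambda>l. l) d < path_length_G (\<lambda>l. l) c" by blast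
    moreover from this have "connects d (proj_B_i (c 0)) (proj_B_i (c 1))"
      by (simp add: connects_def)
    ultimately show False
      using geo path_length_eq_dist_iff[OF c, of "\<lambda>l. l"] unfolding minimal_geodesic_def by force
  qed
  have clo: "closure ({0<..<1::real} \<times> {0<..<2 * pi}) = {0..1} \<times> {0..2 * pi}"
    by (simp add: closure_Times)
  have "g (t, \<theta>) \<le> 0"
  proof (rule continuous_le_on_closure[of "{0<..<1} \<times> {0<..<2 * pi}" g])
    show "continuous_on (closure ({0<..<1} \<times> {0<..<2 * pi})) g"
      unfolding clo g_def
      by (intro continuous_intros c continuous_on_compose2[OF continuous_on_curve_length[OF c]]) auto
  qed (use interior t \<theta> in \<open>auto simp: clo\<close>)
  then show ?thesis by (simp add: g_def)
qed

text \<open>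
  Let \<open>v\<close> be the constant speed. The mean over arc length of the squared normal speed, times
  \<open>\<ell>\<^sup>2\<close>, is exactly \<open>v\<^sup>2\<close>. A continuous function that never exceeds its mean equals it
  everywhere.
\<close>
lemma minimal_geodesic_imp_uniform_normal_speed:
  assumes geo: "minimal_geodesic (\<lambda>l. l) c"
  obtains K where "\<And>t \<theta>. t \<in> {0..1} \<Longrightarrow>
    norm (normal_velocity c t \<theta>) * curve_length (c t) = K"
proof -
  have c: "imm_path c" using geo by (simp add: minimal_geodesic_def)
  obtain v where v: "\<And>t. t \<in> {0..1} \<Longrightarrow> speed (\<lambda>l. l) c t = v"
    using geo by (auto simp: minimal_geodesic_def)
  have "norm (normal_velocity c t \<theta>) * curve_length (c t) = v" if t: "t \<in> {0..1}" for t \<theta>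
  proof -
    define p where "p \<theta> = norm (tangent c t \<theta>)" for \<theta>
    define l where "l = curve_length (c t)"
    \<comment> \<open>The deficit below the mean, as a density in \<open>\<theta>\<close>.\<close>
    define F where "F \<theta> = v\<^sup>2 * p \<theta> - l\<^sup>2 * ((sweep c t \<theta>)\<^sup>2 / p \<theta>)" for \<theta>
    have p: "p \<theta> > 0" for \<theta> using tangent_nonzero[OF c t] by (simp add: p_def)
    have l: "l > 0" using curve_length_pos[OF c t] by (simp add: l_def)
    have "v = sqrt (l * sweep_energy c t)"
      using v[OF t] speed_eq[OF c t] by (simp add: l_def)
    then have v0: "v \<ge> 0" and lE: "l * sweep_energy c t = v\<^sup>2"
      using l sweep_energy_nonneg[OF c t] by auto
    have cont: "continuous_on {0..2 * pi} F"
      unfolding F_def p_def using t c p by (intro continuous_intros) (auto simp: p_def)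
    have "(F has_integral (v\<^sup>2 * l - l\<^sup>2 * sweep_energy c t)) {0..2 * pi}"
      unfolding F_def p_def l_def curve_length_def tangent_def[symmetric] sweep_energy_def
      using t c tangent_nonzero[OF c t]
      by (intro has_integral_diff has_integral_mult_right integrable_integral
          integrable_continuous_real continuous_intros) auto
    moreover have "v\<^sup>2 * l - l\<^sup>2 * sweep_energy c t = 0"
      using lE by (simp add: power2_eq_square algebra_simps)
    ultimately have F_int: "integral {0..2 * pi} F = 0" by (simp add: integral_unique)
    have F_zero: "F y = 0" if y: "y \<in> {0..2 * pi}" for y
    proof (cases "v = 0")
      case True
      have "F \<theta> \<le> 0" for \<theta> using p[of \<theta>] by (simp add: F_def True)
      then have "integral {0..2 * pi} (\<lambda>\<theta>. - F \<theta>) = 0 \<longleftrightarrow> (\<forall>\<theta>\<in>{0..2 * pi}. - F \<theta> = 0)"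
        by (intro integral_eq_0_iff continuous_intros cont) auto
      then show ?thesis using F_int y by simp
    next
      case False
      have "F \<theta> \<ge> 0" if "\<theta> \<in> {0..2 * pi}" for \<theta>
      proof -
        have "\<bar>sweep c t \<theta>\<bar> * l \<le> v * p \<theta>"
          using minimal_geodesic_normal_speed_le[OF geo v _ t that] v0 False
          by (simp add: l_def p_def)
        then have "(\<bar>sweep c t \<theta>\<bar> * l)\<^sup>2 \<le> (v * p \<theta>)\<^sup>2"
          using l by (intro power_mono) auto
        then show ?thesis using p[of \<theta>] by (simp add: F_def power_mult_distrib power2_eq_square field_simps)
      qed
      then show ?thesis
        using integral_eq_0_iff[OF cont] F_int y by simp
    qed
    have "F (\<theta> + 2 * pi) = F \<theta>" for \<theta>
      by (simp add: F_def p_def tangent_periodic[OF c t] sweep_periodic[OF c t])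
    then obtain y where "y \<in> {0..2 * pi}" "F y = F \<theta>" by (rule periodic_representative)
    then have "F \<theta> = 0" using F_zero by simp
    then have "(\<bar>sweep c t \<theta>\<bar> * l)\<^sup>2 = (v * p \<theta>)\<^sup>2"
      using p[of \<theta>] by (simp add: F_def power_mult_distrib power2_eq_square field_simps)
    then have "\<bar>sweep c t \<theta>\<bar> * l = v * p \<theta>"
      using l v0 p[of \<theta>] by (subst (asm) power2_eq_iff_nonneg) auto
    then have "\<bar>sweep c t \<theta>\<bar> / p \<theta> * l = v"
      using p[of \<theta>] by simp
    then show ?thesis
      using norm_normal_velocity[OF tangent_nonzero[OF c t], of \<theta>]
      by (simp add: l_def p_def)
  qed
  then show ?thesis using that by blast
qed

theorem corollary5:
  fixes \<phi> :: "real \<Rightarrow> real" and c :: "real \<Rightarrow> real \<Rightarrow> complex"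
  assumes "\<phi> = (\<lambda>l. l)"
    and "imm_path c"
  shows "minimal_geodesic \<phi> c \<longleftrightarrow>
    (\<exists>K. \<forall>t\<in>{0..1}. \<forall>\<theta>. norm (normal_velocity c t \<theta>) * curve_length (c t) = K)"
proof
  assume "minimal_geodesic \<phi> c"
  then show "\<exists>K. \<forall>t\<in>{0..1}. \<forall>\<theta>. norm (normal_velocity c t \<theta>) * curve_length (c t) = K"
    using minimal_geodesic_imp_uniform_normal_speed[of c] assms(1) by metis
next
  assume "\<exists>K. \<forall>t\<in>{0..1}. \<forall>\<theta>. norm (normal_velocity c t \<theta>) * curve_length (c t) = K"
  then show "minimal_geodesic \<phi> c"
    using uniform_normal_speed_imp_minimal_geodesic[OF assms(2)] assms(1) by blast
qed

end
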